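(* Let $G=(V,E,\infty)$ be a temporal graph with unrestricted waiting, with $n=|V|$ and $M=|E|$, given in doubly-sorted representation (the list $E^{\mathrm{arr}}$ of its temporal edges sorted by non-decreasing arrival time and the list $E^{\mathrm{dep}}$ sorted by non-decreasing departure time). There is an algorithm that, for any source $s\in V$, correctly computes the $s$-SFo betweenness $b_{s,e}$ of every temporal edge $e\in E$ using $O(M)$ operations. Consequently (repeating for every source) the SFo betweenness of all nodes can be computed in time $O(nM)$.
   Context: A temporal graph is a triple $G=(V,E,\beta)$ with $\beta\in\mathbb{N}\cup\{+\infty\}$ the maximum waiting time; here $\beta=+\infty$. A temporal edge is a quadruple $e=(u,v,\tau,\lambda)$ with tail $u\in V$, head $v\in V$, departure time $\mathrm{dep}(e)=\tau\in\mathbb{N}$ and travel time $\lambda\in\mathbb{N}^{+}$ (positive); its arrival time is $\mathrm{arr}(e)=\tau+\lambda$. A walk from $s$ to $t$ ($st$-walk) is a sequence $e_1,\dots,e_k$ of temporal edges $e_i=(u_i,v_i,\tau_i,\lambda_i)$ with $u_1=s$, $v_k=t$, and for each $i<k$: $u_{i+1}=v_i$ and $\mathrm{arr}(e_i)\le\tau_{i+1}\le\mathrm{arr}(e_i)+\beta$; it is also called an $se_k$-walk. Its length $|W|$ is $k$, and $\mathrm{arr}(W)=\mathrm{arr}(e_k)$. Write $(a,b)\vartriangleleft(c,d)$ iff $a<c$ or ($a=c$ and $b<d$). An $st$-walk $W$ is shortest foremost (SFo) if there is no $st$-walk $X$ with $(\mathrm{arr}(X),|X|)\vartriangleleft(\mathrm{arr}(W),|W|)$.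 For $s\neq t$ and $e\in E$, $\sigma^*_{s,e,t}$ is the number of SFo $st$-walks containing $e$ and $\sigma^*_{s,t}=\sum_{e\in E^{\mathrm h}_t}\sigma^*_{s,e,t}$, where $E^{\mathrm h}_t$ is the set of temporal edges with head $t$. Let $\chi_{s,t}=1$ if $s\ne t$ and an $st$-walk exists, and $\chi_{s,t}=0$ otherwise. The $s$-SFo betweenness of a temporal edge $e$ is $b_{s,e}=\sum_{t\in V:\chi_{s,t}=1}\sigma^*_{s,e,t}/\sigma^*_{s,t}$. For a node $u$, $\sigma^*_{s,u,t}=\sum_{e\in E^{\mathrm h}_u}\sigma^*_{s,e,t}$ (so a walk visiting $u$ several times is counted with multiplicity), and the SFo betweenness of $u$ is $b_u=\sum_{s,t\in V\setminus\{u\},\chi_{s,t}=1}\sigma^*_{s,u,t}/\sigma^*_{s,t}$. *)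

theory Defs
  imports Complex_Main "HOL-Library.Extended_Nat"
begin

section \<open>Temporal graphs and walks\<close>

text \<open>A temporal edge is a quadruple (tail, head, departure time, travel time).\<close>

type_synonym 'v tedge = "'v \<times> 'v \<times> nat \<times> nat"

fun tail :: "'v tedge \<Rightarrow> 'v" where "tail (u, v, t, l) = u"
fun head :: "'v tedge \<Rightarrow> 'v" where "head (u, v, t, l) = v"
fun dep :: "'v tedge \<Rightarrow> nat" where "dep (u, v, t, l) = t"
fun trav :: "'v tedge \<Rightarrow> nat" where "trav (u, v, t, l) = l"

definition arr :: "'v tedge \<Rightarrow> nat" where
  "arr e = dep e + trav e"

record 'v tgraph =
  verts :: "'v set"
  edges :: "'v tedge set"
  max_wait :: enat

definition temporal_graph :: "'v tgraph \<Rightarrow> bool" where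
  "temporal_graph G \<longleftrightarrow> finite (verts G) \<and> finite (edges G) \<and>
     (\<forall>e \<in> edges G. tail e \<in> verts G \<and> head e \<in> verts G \<and> 0 < trav e)"

definition walk :: "'v tgraph \<Rightarrow> 'v \<Rightarrow> 'v \<Rightarrow> 'v tedge list \<Rightarrow> bool" where
  "walk G s t W \<longleftrightarrow> W \<noteq> [] \<and> set W \<subseteq> edges G \<and> tail (hd W) = s \<and> head (last W) = t \<and>
     (\<forall>i. Suc i < length W \<longrightarrow>
        tail (W ! Suc i) = head (W ! i) \<and>
        arr (W ! i) \<le> dep (W ! Suc i) \<and>
        enat (dep (W ! Suc i)) \<le> enat (arr (W ! i)) + max_wait G)"

definition walk_arr :: "'v tedge list \<Rightarrow> nat" where
  "walk_arr W = arr (last W)"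

definition lex_less :: "nat \<times> nat \<Rightarrow> nat \<times> nat \<Rightarrow> bool" where
  "lex_less p q \<longleftrightarrow> fst p < fst q \<or> fst p = fst q \<and> snd p < snd q"

section \<open>Shortest foremost walks and betweenness\<close>

definition SFo_walk :: "'v tgraph \<Rightarrow> 'v \<Rightarrow> 'v \<Rightarrow> 'v tedge list \<Rightarrow> bool" where
  "SFo_walk G s t W \<longleftrightarrow> walk G s t W \<and>
     \<not> (\<exists>X. walk G s t X \<and> lex_less (walk_arr X, length X) (walk_arr W, length W))"

definition in_edges :: "'v tgraph \<Rightarrow> 'v \<Rightarrow> 'v tedge set" where
  "in_edges G t = {e \<in> edges G. head e = t}"

definition sigma_edge :: "'v tgraph \<Rightarrow> 'v \<Rightarrow> 'v tedge \<Rightarrow> 'v \<Rightarrow> nat" where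
  "sigma_edge G s e t = card {W. SFo_walk G s t W \<and> e \<in> set W}"

definition sigma :: "'v tgraph \<Rightarrow> 'v \<Rightarrow> 'v \<Rightarrow> nat" where
  "sigma G s t = (\<Sum>e \<in> in_edges G t. sigma_edge G s e t)"

definition sigma_node :: "'v tgraph \<Rightarrow> 'v \<Rightarrow> 'v \<Rightarrow> 'v \<Rightarrow> nat" where
  "sigma_node G s u t = (\<Sum>e \<in> in_edges G u. sigma_edge G s e t)"

definition chi :: "'v tgraph \<Rightarrow> 'v \<Rightarrow> 'v \<Rightarrow> nat" where
  "chi G s t = (if s \<noteq> t \<and> (\<exists>W. walk G s t W) then 1 else 0)"

definition edge_betweenness :: "'v tgraph \<Rightarrow> 'v \<Rightarrow> 'v tedge \<Rightarrow> rat" where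
  "edge_betweenness G s e =
     (\<Sum>t \<in> {t \<in> verts G. chi G s t = 1}. of_nat (sigma_edge G s e t) / of_nat (sigma G s t))"

definition node_betweenness :: "'v tgraph \<Rightarrow> 'v \<Rightarrow> rat" where
  "node_betweenness G u =
     (\<Sum>(s, t) \<in> {(s, t). s \<in> verts G - {u} \<and> t \<in> verts G - {u} \<and> chi G s t = 1}.
        of_nat (sigma_node G s u t) / of_nat (sigma G s t))"

section \<open>Doubly-sorted representation\<close>

definition doubly_sorted :: "'v tgraph \<Rightarrow> 'v tedge list \<Rightarrow> 'v tedge list \<Rightarrow> bool" where
  "doubly_sorted G Earr Edep \<longleftrightarrow>
     distinct Earr \<and> set Earr = edges G \<and> sorted (map arr Earr) \<and>
     distinct Edep \<and> set Edep = edges G \<and> sorted (map dep Edep)"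

section \<open>Unit-cost programs\<close>

text \<open>
  Algorithms are programs of a structured random-access machine. Its memory consists of named
  unbounded arrays, one family holding natural numbers (the only values usable as addresses) and
  one holding rational numbers; a scalar variable is cell 0 of an array. Every constant, memory
  access, arithmetic operation, comparison, connective and control step costs one unit,
  independently of the size of the numbers involved. There is no operation converting
  rationals to naturals, no division or rounding on naturals, and no bulk operation on arrays.
  Subtraction of naturals is truncated and division by 0 yields 0, as in HOL.
\<close>

record store =
  natmem :: "string \<Rightarrow> nat \<Rightarrow> nat"
  ratmem :: "string \<Rightarrow> nat \<Rightarrow> rat"

datatype nexp =
    NConst nat
  | NRead string nexp
  | NAdd nexp nexp
  | NSub nexp nexp
  | NMul nexp nexp

datatype qexp =
    QOf nexp
  | QRead string nexp
  | QAdd qexp qexp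
  | QSub qexp qexp
  | QMul qexp qexp
  | QDiv qexp qexp

datatype bexp =
    NLess nexp nexp
  | NEq nexp nexp
  | QLess qexp qexp
  | QEq qexp qexp
  | BNot bexp
  | BAnd bexp bexp

datatype com =
    Skip
  | NWrite string nexp nexp
  | QWrite string nexp qexp
  | Seq com com
  | Cond bexp com com
  | While bexp com

primrec nval :: "nexp \<Rightarrow> store \<Rightarrow> nat" where
  "nval (NConst k) \<sigma> = k"
| "nval (NRead x a) \<sigma> = natmem \<sigma> x (nval a \<sigma>)"
| "nval (NAdd a b) \<sigma> = nval a \<sigma> + nval b \<sigma>"
| "nval (NSub a b) \<sigma> = nval a \<sigma> - nval b \<sigma>"
| "nval (NMul a b) \<sigma> = nval a \<sigma> * nval b \<sigma>"

primrec qval :: "qexp \<Rightarrow> store \<Rightarrow> rat" where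
  "qval (QOf a) \<sigma> = of_nat (nval a \<sigma>)"
| "qval (QRead x a) \<sigma> = ratmem \<sigma> x (nval a \<sigma>)"
| "qval (QAdd p q) \<sigma> = qval p \<sigma> + qval q \<sigma>"
| "qval (QSub p q) \<sigma> = qval p \<sigma> - qval q \<sigma>"
| "qval (QMul p q) \<sigma> = qval p \<sigma> * qval q \<sigma>"
| "qval (QDiv p q) \<sigma> = qval p \<sigma> / qval q \<sigma>"

primrec bval :: "bexp \<Rightarrow> store \<Rightarrow> bool" where
  "bval (NLess a b) \<sigma> \<longleftrightarrow> nval a \<sigma> < nval b \<sigma>"
| "bval (NEq a b) \<sigma> \<longleftrightarrow> nval a \<sigma> = nval b \<sigma>"
| "bval (QLess p q) \<sigma> \<longleftrightarrow> qval p \<sigma> < qval q \<sigma>"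
| "bval (QEq p q) \<sigma> \<longleftrightarrow> qval p \<sigma> = qval q \<sigma>"
| "bval (BNot b) \<sigma> \<longleftrightarrow> \<not> bval b \<sigma>"
| "bval (BAnd b c) \<sigma> \<longleftrightarrow> bval b \<sigma> \<and> bval c \<sigma>"

primrec ncost :: "nexp \<Rightarrow> nat" where
  "ncost (NConst k) = 1"
| "ncost (NRead x a) = ncost a + 1"
| "ncost (NAdd a b) = ncost a + ncost b + 1"
| "ncost (NSub a b) = ncost a + ncost b + 1"
| "ncost (NMul a b) = ncost a + ncost b + 1"

primrec qcost :: "qexp \<Rightarrow> nat" where
  "qcost (QOf a) = ncost a + 1"
| "qcost (QRead x a) = ncost a + 1"
| "qcost (QAdd p q) = qcost p + qcost q + 1"
| "qcost (QSub p q) = qcost p + qcost q + 1"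
| "qcost (QMul p q) = qcost p + qcost q + 1"
| "qcost (QDiv p q) = qcost p + qcost q + 1"

primrec bcost :: "bexp \<Rightarrow> nat" where
  "bcost (NLess a b) = ncost a + ncost b + 1"
| "bcost (NEq a b) = ncost a + ncost b + 1"
| "bcost (QLess p q) = qcost p + qcost q + 1"
| "bcost (QEq p q) = qcost p + qcost q + 1"
| "bcost (BNot b) = bcost b + 1"
| "bcost (BAnd b c) = bcost b + bcost c + 1"

definition nwrite :: "string \<Rightarrow> nat \<Rightarrow> nat \<Rightarrow> store \<Rightarrow> store" where
  "nwrite x i k \<sigma> = \<sigma>\<lparr>natmem := (natmem \<sigma>)(x := (natmem \<sigma> x)(i := k))\<rparr>"

definition qwrite :: "string \<Rightarrow> nat \<Rightarrow> rat \<Rightarrow> store \<Rightarrow> store" where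
  "qwrite x i q \<sigma> = \<sigma>\<lparr>ratmem := (ratmem \<sigma>)(x := (ratmem \<sigma> x)(i := q))\<rparr>"

text \<open>\<open>exec c \<sigma> T \<sigma>'\<close>: started in \<open>\<sigma>\<close>, the program \<open>c\<close> halts in \<open>\<sigma>'\<close>
  after exactly \<open>T\<close> operations.\<close>

inductive exec :: "com \<Rightarrow> store \<Rightarrow> nat \<Rightarrow> store \<Rightarrow> bool" where
  exec_Skip: "exec Skip \<sigma> 1 \<sigma>"
| exec_NWrite: "exec (NWrite x a b) \<sigma> (ncost a + ncost b + 1) (nwrite x (nval a \<sigma>) (nval b \<sigma>) \<sigma>)"
| exec_QWrite: "exec (QWrite x a q) \<sigma> (ncost a + qcost q + 1) (qwrite x (nval a \<sigma>) (qval q \<sigma>) \<sigma>)"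
| exec_Seq: "exec c \<sigma> T \<sigma>' \<Longrightarrow> exec d \<sigma>' T' \<sigma>'' \<Longrightarrow> exec (Seq c d) \<sigma> (T + T') \<sigma>''"
| exec_CondT: "bval b \<sigma> \<Longrightarrow> exec c \<sigma> T \<sigma>' \<Longrightarrow> exec (Cond b c d) \<sigma> (bcost b + 1 + T) \<sigma>'"
| exec_CondF: "\<not> bval b \<sigma> \<Longrightarrow> exec d \<sigma> T \<sigma>' \<Longrightarrow> exec (Cond b c d) \<sigma> (bcost b + 1 + T) \<sigma>'"
| exec_WhileF: "\<not> bval b \<sigma> \<Longrightarrow> exec (While b c) \<sigma> (bcost b + 1) \<sigma>"
| exec_WhileT: "bval b \<sigma> \<Longrightarrow> exec c \<sigma> T \<sigma>' \<Longrightarrow> exec (While b c) \<sigma>' T' \<sigma>'' \<Longrightarrow>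
    exec (While b c) \<sigma> (bcost b + 1 + T + T') \<sigma>''"

inductive_cases exec_SkipE: "exec Skip \<sigma> T \<sigma>'"
inductive_cases exec_NWriteE: "exec (NWrite x a b) \<sigma> T \<sigma>'"
inductive_cases exec_QWriteE: "exec (QWrite x a q) \<sigma> T \<sigma>'"
inductive_cases exec_SeqE: "exec (Seq c d) \<sigma> T \<sigma>'"
inductive_cases exec_CondE: "exec (Cond b c d) \<sigma> T \<sigma>'"
inductive_cases exec_WhileE: "exec (While b c) \<sigma> T \<sigma>'"

lemma exec_deterministic:
  "exec c \<sigma> T \<sigma>' \<Longrightarrow> exec c \<sigma> U \<tau> \<Longrightarrow> U = T \<and> \<tau> = \<sigma>'"
proof (induction arbitrary: U \<tau> rule: exec.induct)
  case exec_Skip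
  from exec_Skip show ?case by (rule exec_SkipE) simp
next
  case exec_NWrite
  from exec_NWrite show ?case by (rule exec_NWriteE) simp
next
  case exec_QWrite
  from exec_QWrite show ?case by (rule exec_QWriteE) simp
next
  case (exec_Seq c \<sigma> T \<sigma>' d T' \<sigma>'')
  from exec_Seq.prems show ?case
    by (rule exec_SeqE) (use exec_Seq.IH in metis)
next
  case (exec_CondT b \<sigma> c T \<sigma>' d)
  from exec_CondT.prems show ?case
    by (rule exec_CondE) (use exec_CondT.hyps(1) in \<open>auto dest: exec_CondT.IH\<close>)+
next
  case (exec_CondF b \<sigma> d T \<sigma>' c)
  from exec_CondF.prems show ?case
    by (rule exec_CondE) (use exec_CondF.hyps(1) in \<open>auto dest: exec_CondF.IH\<close>)+
next
  case (exec_WhileF b \<sigma> c)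
  from exec_WhileF.prems show ?case
    by (rule exec_WhileE) (use exec_WhileF.hyps in auto)+
next
  case (exec_WhileT b \<sigma> c T \<sigma>' T' \<sigma>'')
  from exec_WhileT.prems show ?case
    by (rule exec_WhileE) (use exec_WhileT.hyps(1) in \<open>auto dest: exec_WhileT.IH\<close>)+
qed

section \<open>Input in memory\<close>

text \<open>
  Nodes are identified by natural numbers, not necessarily consecutive. Both edge lists are stored
  as plain quadruples, without pointers between them. Cells not mentioned have arbitrary contents.
\<close>

definition holds_edges ::
    "store \<Rightarrow> string \<Rightarrow> string \<Rightarrow> string \<Rightarrow> string \<Rightarrow> nat tedge list \<Rightarrow> bool" where
  "holds_edges \<sigma> xu xv xt xl es \<longleftrightarrow> (\<forall>i < length es.
     natmem \<sigma> xu i = tail (es ! i) \<and> natmem \<sigma> xv i = head (es ! i) \<and>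
     natmem \<sigma> xt i = dep (es ! i) \<and> natmem \<sigma> xl i = trav (es ! i))"

definition holds_input ::
    "store \<Rightarrow> nat tgraph \<Rightarrow> nat tedge list \<Rightarrow> nat tedge list \<Rightarrow> bool" where
  "holds_input \<sigma> G Earr Edep \<longleftrightarrow>
     natmem \<sigma> ''n'' 0 = card (verts G) \<and>
     natmem \<sigma> ''M'' 0 = card (edges G) \<and>
     bij_betw (natmem \<sigma> ''node'') {..<card (verts G)} (verts G) \<and>
     holds_edges \<sigma> ''arr_tail'' ''arr_head'' ''arr_dep'' ''arr_trav'' Earr \<and>
     holds_edges \<sigma> ''dep_tail'' ''dep_head'' ''dep_dep'' ''dep_trav'' Edep"

end

theory Submission
  imports Defs
begin

text \<open>
  Fix a source \<open>s\<close>. With unrestricted waiting, every prefix of a shortest \<open>se\<close>-walk is again shortest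
  for its last edge, so the shortest \<open>se\<close>-walks are the paths of a DAG on temporal edges: \<open>e\<close> precedes
  \<open>f\<close> iff \<open>f\<close> can follow \<open>e\<close> and its walk distance is one larger. The SFo walks to \<open>t\<close> are the DAG
  paths that end in an edge into \<open>t\<close> with lexicographically least arrival time and distance. Hence
  \<open>b\<^bsub>s,e\<^esub>\<close> is the number of shortest \<open>se\<close>-walks times a quantity \<open>delta e\<close> obtained by summing
  \<open>delta\<close> over the successors of \<open>e\<close>, and omitting the final-edge term from \<open>delta e\<close> removes exactly the
  summand \<open>t = u\<close> that the betweenness of the node \<open>u = head e\<close> excludes.

  Sweeping all departures and arrivals forwards in time gives distances and counts, because the
  edges that can precede a departing edge are those that have already arrived at its tail. Sweeping
  backwards gives \<open>delta\<close>. No sorting or pointer structure is needed to identify the two occurrences of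
  an edge: the data of an edge are stored at an address computed by an injective polynomial.
\<close>

section \<open>Counting shortest foremost walks\<close>

text \<open>Dynamic programming has to run on edges, not on nodes: a prefix of an SFo walk need be
  neither foremost nor shortest among all walks to the node where it stops, only shortest among the
  walks with the same last edge. Unrestricted waiting then lets the tables be indexed by nodes
  again. An edge that has arrived at \<open>v\<close> can be continued by every later departure from
  \<open>v\<close> and never expires, so one running minimum of distances per node, with the number
  of walks attaining it, answers each departure in constant time. Backwards, a running sum of
  \<open>delta\<close> over the departures from \<open>v\<close>, kept separately for each distance,
  does the same for the successors of an edge. Two features of the machine shape the rest. Memory
  starts with arbitrary contents, and the number of nodes may far exceed the number of edges, so
  within O(M) only cells addressed through edges may be initialised. Shortest walks never return to
  \<open>s\<close>, because an edge leaving \<open>s\<close> has distance 1; this removes the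
  special case of a node that is itself the source.\<close>

declare split_paired_All [simp del] split_paired_Ex [simp del]

locale sfo =
  fixes G :: "'v tgraph" and s :: 'v
  assumes graph: "temporal_graph G" and unrestricted: "max_wait G = \<infinity>"
begin

abbreviation E :: "'v tedge set" where "E \<equiv> edges G"
abbreviation M :: nat where "M \<equiv> card (edges G)"

definition link :: "'v tedge \<Rightarrow> 'v tedge \<Rightarrow> bool" where
  "link e f \<longleftrightarrow> head e = tail f \<and> arr e \<le> dep f"

definition swalk :: "'v tedge list \<Rightarrow> bool" where
  "swalk W \<longleftrightarrow> W \<noteq> [] \<and> set W \<subseteq> E \<and> tail (hd W) = s \<and> successively link W"

definition reach :: "'v tedge \<Rightarrow> bool" where
  "reach e \<longleftrightarrow> (\<exists>W. swalk W \<and> last W = e)"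

text \<open>The value \<open>M + 2\<close> for unreachable edges is one more than the distance \<open>M + 1\<close> given to nodes at which
  nothing has arrived, so \<open>dist_step\<close> needs no case distinction; no edge has distance \<open>M + 1\<close>.\<close>

definition dist :: "'v tedge \<Rightarrow> nat" where
  "dist e = (if reach e then LEAST n. \<exists>W. swalk W \<and> last W = e \<and> length W = n else M + 2)"

definition shortest :: "'v tedge \<Rightarrow> 'v tedge list set" where
  "shortest e = {W. swalk W \<and> last W = e \<and> length W = dist e}"

definition count :: "'v tedge \<Rightarrow> nat" where
  "count e = card (shortest e)"

text \<open>The default distance makes reachability implicit: an unreached edge on either side would
  require a distance \<open>M + 3\<close> or \<open>M + 1\<close>, which no edge has.\<close>

definition pre :: "'v tedge \<Rightarrow> 'v tedge \<Rightarrow> bool" where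
  "pre e f \<longleftrightarrow> link e f \<and> dist f = Suc (dist e)"

text \<open>Reachable edges have \<open>dist e \<le> M\<close>, so \<open>key\<close> orders them lexicographically by arrival time and
  distance.\<close>

definition key :: "'v tedge \<Rightarrow> nat" where
  "key e = arr e * (M + 3) + dist e"

text \<open>These are precisely the last edges of SFo walks to targets other than \<open>s\<close>;
  excluding the head \<open>s\<close> mirrors the condition \<open>s \<noteq> t\<close> in
  \<open>chi\<close>.\<close>

definition final :: "'v tedge \<Rightarrow> bool" where
  "final e \<longleftrightarrow> reach e \<and> head e \<noteq> s \<and> (\<forall>f. reach f \<and> head f = head e \<longrightarrow> key e \<le> key f)"

text \<open>For \<open>t \<noteq> s\<close> this is \<open>sigma G s t\<close> (see
  \<open>sigma_eq\<close>): an SFo walk to \<open>t\<close> enters \<open>t\<close> only by its last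
  edge, so it is counted once.\<close>

definition total :: "'v \<Rightarrow> nat" where
  "total t = (\<Sum>e | final e \<and> head e = t. count e)"

text \<open>The ways to continue a shortest walk ending in \<open>e\<close> to an SFo walk to
  \<open>t\<close>. They depend on \<open>e\<close> alone and not on the walk leading to it, which
  makes \<open>sigma_edge\<close> a product. With \<open>e\<close> kept in front,
  \<open>Q = []\<close> covers the case that \<open>e\<close> is itself the last edge.\<close>

definition completions :: "'v \<Rightarrow> 'v tedge \<Rightarrow> 'v tedge list set" where
  "completions t e = {Q. set Q \<subseteq> E \<and> successively pre (e # Q) \<and>
     final (last (e # Q)) \<and> head (last (e # Q)) = t}"

definition delta :: "'v tedge \<Rightarrow> rat" where
  "delta e = (\<Sum>t | t \<in> verts G \<and> chi G s t = 1. of_nat (card (completions t e)) / of_nat (total t))"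

definition succ_delta :: "'v tedge \<Rightarrow> rat" where
  "succ_delta e = (\<Sum>f | f \<in> E \<and> pre e f. delta f)"

section \<open>Walks from the source as chains of links\<close>

lemma finite_E [simp]: "finite E" and finite_verts [simp]: "finite (verts G)"
  using graph by (auto simp: temporal_graph_def)

lemma dep_less_arr: "e \<in> E \<Longrightarrow> dep e < arr e"
  using graph by (auto simp: temporal_graph_def arr_def)

lemma head_in_verts: "e \<in> E \<Longrightarrow> head e \<in> verts G"
  using graph by (auto simp: temporal_graph_def)

text \<open>Infinite \<open>max_wait\<close> makes the upper bound on waiting vacuous, so
  consecutive edges only have to meet in a node and be in temporal order.\<close>

lemma walk_iff_swalk: "walk G s t W \<longleftrightarrow> swalk W \<and> head (last W) = t"
  by (auto simp: walk_def swalk_def successively_conv_nth link_def unrestricted)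

text \<open>Positive travel times give \<open>arr e \<le> dep f < arr f\<close> along a link. Hence
  walks repeat no edge, which bounds their length by \<open>M\<close> and makes all sets of walks
  below finite.\<close>

lemma sorted_links:
  assumes "set W \<subseteq> E" "successively link W"
  shows "sorted_wrt (\<lambda>e f. arr e < arr f) W"
proof -
  have "successively (\<lambda>e f. arr e < arr f) W"
    using assms(2)
  proof (rule successively_mono)
    fix e f assume "f \<in> set W" "link e f"
    then show "arr e < arr f" using assms(1) dep_less_arr[of f] by (auto simp: link_def)
  qed
  then show ?thesis
    by (subst (asm) successively_iff_sorted_wrt_strong) auto
qed

lemma distinct_links:
  assumes "set W \<subseteq> E" "successively link W"
  shows "distinct W"
proof -
  have "sorted_wrt (<) (map arr W)"
    using sorted_links[OF assms] by (simp add: sorted_wrt_map)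
  then show ?thesis
    using strict_sorted_iff distinct_map by blast
qed

lemma swalk_length_le: "swalk W \<Longrightarrow> length W \<le> M"
  unfolding swalk_def
  by (metis card_mono distinct_card distinct_links finite_E)

lemma swalk_singleton: "swalk [f] \<longleftrightarrow> f \<in> E \<and> tail f = s"
  by (auto simp: swalk_def)

lemma swalk_snoc:
  "W \<noteq> [] \<Longrightarrow> swalk (W @ [f]) \<longleftrightarrow> swalk W \<and> link (last W) f \<and> f \<in> E"
  by (auto simp: swalk_def successively_append_iff)

lemma reachI: "swalk W \<Longrightarrow> reach (last W)"
  by (auto simp: reach_def)

lemma reach_in_E: "reach e \<Longrightarrow> e \<in> E"
  by (auto simp: reach_def swalk_def)

lemma finite_reach [simp]: "finite {e. reach e}"
  by (rule finite_subset[of _ E]) (auto simp: reach_in_E)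

lemma final_reach: "final e \<Longrightarrow> reach e"
  by (simp add: final_def)

section \<open>Distances, shortest walks and their recurrences\<close>

lemma dist_le: "swalk W \<Longrightarrow> dist (last W) \<le> length W"
  unfolding dist_def using reachI by (auto intro: Least_le)

lemma shortest_nonempty:
  assumes "reach e" shows "\<exists>W. W \<in> shortest e"
proof -
  have "\<exists>n. \<exists>W. swalk W \<and> last W = e \<and> length W = n"
    using assms by (auto simp: reach_def)
  from LeastI_ex[OF this] show ?thesis
    using assms by (auto simp: shortest_def dist_def)
qed

lemma dist_le_M: "reach e \<Longrightarrow> dist e \<le> M"
  using shortest_nonempty swalk_length_le by (fastforce simp: shortest_def)

lemma dist_unreached: "\<not> reach e \<Longrightarrow> dist e = M + 2"
  by (simp add: dist_def)

text \<open>Reachability as a numerical test: the program keeps no flag for it, and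
  \<open>ereach\<close> evaluates this inequality.\<close>

lemma reach_iff_dist: "reach e \<longleftrightarrow> dist e < M + 1"
  using dist_le_M[of e] dist_unreached[of e] by force

lemma dist_pos: "0 < dist e"
proof (cases "reach e")
  case True
  then obtain W where "swalk W" "length W = dist e"
    using shortest_nonempty[of e] by (auto simp: shortest_def)
  then show ?thesis by (metis length_greater_0_conv swalk_def)
qed (simp add: dist_unreached)

lemma shortest_unreached: "\<not> reach e \<Longrightarrow> shortest e = {}"
  by (auto simp: shortest_def reach_def)

lemma finite_shortest [simp]: "finite (shortest e)"
proof (rule finite_subset)
  show "shortest e \<subseteq> {W. set W \<subseteq> E \<and> length W \<le> M}"
    using swalk_length_le by (auto simp: shortest_def swalk_def)
qed (simp add: finite_lists_length_le)

lemma count_pos_iff: "0 < count e \<longleftrightarrow> reach e"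
  using shortest_nonempty[of e] shortest_unreached[of e] by (auto simp: count_def card_gt_0_iff)

lemma dist_source: "f \<in> E \<Longrightarrow> tail f = s \<Longrightarrow> dist f = 1"
  using dist_le[of "[f]"] dist_pos[of f] by (simp add: swalk_singleton)

lemma link_dist_le:
  assumes "reach e" "link e f" "f \<in> E"
  shows "reach f \<and> dist f \<le> Suc (dist e)"
proof -
  obtain W where W: "swalk W" "last W = e" "length W = dist e"
    using shortest_nonempty[OF assms(1)] by (auto simp: shortest_def)
  moreover have "W \<noteq> []" using W by (simp add: swalk_def)
  ultimately have "swalk (W @ [f])" using assms by (simp add: swalk_snoc)
  from dist_le[OF this] reachI[OF this] W show ?thesis by simp
qed

text \<open>A shorter walk with the same last edge as \<open>W\<close> could also be extended by
  \<open>f\<close>, since whether \<open>f\<close> may follow depends on \<open>last W\<close>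
  alone. So the prefix of a shortest walk is shortest, and the two distances differ by one.\<close>

lemma shortest_snoc:
  assumes "W \<noteq> []" "f \<in> E"
  shows "W @ [f] \<in> shortest f \<longleftrightarrow> W \<in> shortest (last W) \<and> pre (last W) f"
proof
  assume L: "W @ [f] \<in> shortest f"
  then have W: "swalk W" "link (last W) f" "dist f = Suc (length W)"
    using assms by (auto simp: shortest_def swalk_snoc)
  then have "dist f \<le> Suc (dist (last W))" "dist (last W) \<le> length W"
    using link_dist_le[of "last W" f] assms reachI dist_le by auto
  then have "length W = dist (last W)" using W(3) by simp
  then show "W \<in> shortest (last W) \<and> pre (last W) f"
    using W by (simp add: shortest_def pre_def)
next
  assume "W \<in> shortest (last W) \<and> pre (last W) f"
  then show "W @ [f] \<in> shortest f"
    using assms by (auto simp: shortest_def pre_def swalk_snoc)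
qed

lemma shortest_singleton: "[f] \<in> shortest f \<longleftrightarrow> f \<in> E \<and> tail f = s"
  using dist_source[of f] by (simp add: shortest_def swalk_singleton) metis

lemma shortest_in_self: "W \<in> shortest e \<Longrightarrow> W \<in> shortest (last W) \<and> last W = e \<and> W \<noteq> []"
  by (auto simp: shortest_def swalk_def)

text \<open>Iterates \<open>shortest_snoc\<close> from the right, with the prefix \<open>P\<close>
  fixed: extending a shortest walk keeps it shortest exactly along paths of the DAG.\<close>

lemma shortest_append:
  assumes "P \<in> shortest e" "set Q \<subseteq> E"
  shows "P @ Q \<in> shortest (last (e # Q)) \<longleftrightarrow> successively pre (e # Q)"
  using assms(2)
proof (induction Q rule: rev_induct)
  case Nil
  then show ?case using assms by simp
next
  case (snoc f Q)
  have ne: "P \<noteq> []" and l: "last P = e" using assms(1) shortest_in_self by auto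
  have "last (P @ Q) = last (e # Q)" using l by auto
  then have "(P @ Q) @ [f] \<in> shortest f \<longleftrightarrow>
      P @ Q \<in> shortest (last (e # Q)) \<and> pre (last (e # Q)) f"
    using shortest_snoc[of "P @ Q" f] ne snoc.prems by simp
  moreover have "successively pre (e # Q @ [f]) \<longleftrightarrow> successively pre (e # Q) \<and> pre (last (e # Q)) f"
    using successively_append_iff[of pre "e # Q" "[f]"] by simp
  ultimately show ?case using snoc by simp
qed

lemma dist_step:
  assumes "f \<in> E" "tail f \<noteq> s"
  shows "dist f = Suc (Min (insert (M + 1) (dist ` {e \<in> E. link e f})))"
proof -
  let ?A = "insert (M + 1) (dist ` {e \<in> E. link e f})"
  have fin: "finite ?A" by simp
  show ?thesis
  proof (cases "reach f")
    case True
    then obtain W' where W': "W' \<in> shortest f" using shortest_nonempty by blast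
    define W where "W = butlast W'"
    have W'eq: "W' = W @ [f]"
      using W' shortest_in_self W_def by (metis append_butlast_last_id)
    \<comment> \<open>Since \<open>f\<close> does not leave \<open>s\<close>, a shortest walk to
      \<open>f\<close> has a penultimate edge; that edge attains the minimum.\<close>
    have "W \<noteq> []" using W' assms W'eq by (auto simp: shortest_singleton)
    then have W: "W \<in> shortest (last W)" "pre (last W) f"
      using W' W'eq shortest_snoc assms by auto
    let ?e = "last W"
    have re: "reach ?e" using W by (auto simp: shortest_def reachI)
    have "Min ?A = dist ?e"
    proof (rule Min_eqI[OF fin])
      show "dist ?e \<in> ?A" using W re reach_in_E by (auto simp: pre_def)
    next
      fix y assume "y \<in> ?A"
      then show "dist ?e \<le> y"
      proof
        assume "y = M + 1" then show ?thesis using dist_le_M[OF re] by simp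
      next
        assume "y \<in> dist ` {e \<in> E. link e f}"
        then obtain e where e: "e \<in> E" "link e f" "y = dist e" by auto
        show ?thesis
        proof (cases "reach e")
          case True
          then show ?thesis using link_dist_le[OF True e(2) assms(1)] W e by (simp add: pre_def)
        next
          case False
          then show ?thesis using e dist_le_M[OF re] by (simp add: dist_unreached)
        qed
      qed
    qed
    then show ?thesis using W by (simp add: pre_def)
  next
    case False
    \<comment> \<open>All predecessors of an unreached edge are unreached and contribute
      \<open>M + 2\<close>, so the inserted \<open>M + 1\<close> is the least element.\<close>
    have "Min ?A = M + 1"
    proof (rule Min_eqI[OF fin])
      fix y assume "y \<in> ?A"
      then show "M + 1 \<le> y"
      proof
        assume "y \<in> dist ` {e \<in> E. link e f}"
        then obtain e where e: "link e f" "y = dist e" by blast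
        then have "\<not> reach e" using False link_dist_le assms(1) by blast
        then show ?thesis using e dist_unreached by simp
      qed simp
    qed simp
    then show ?thesis using False by (simp add: dist_unreached)
  qed
qed

lemma count_source:
  assumes "f \<in> E" "tail f = s"
  shows "count f = 1"
proof -
  have "shortest f = {[f]}"
  proof (intro set_eqI iffI)
    fix W assume "W \<in> shortest f"
    then have "length W = 1" "last W = f" using dist_source assms by (auto simp: shortest_def)
    then show "W \<in> {[f]}" by (cases W) auto
  qed (use assms shortest_singleton in auto)
  then show ?thesis by (simp add: count_def)
qed

text \<open>Splits the shortest walks by their penultimate edge; the parts are disjoint because
  members of \<open>shortest e\<close> end in \<open>e\<close>.\<close>

lemma count_step:
  assumes "f \<in> E" "tail f \<noteq> s"
  shows "count f = (\<Sum>e | e \<in> E \<and> pre e f. count e)"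
proof -
  have "shortest f = (\<Union>e\<in>{e \<in> E. pre e f}. (\<lambda>W. W @ [f]) ` shortest e)" (is "_ = ?R")
  proof (intro set_eqI iffI)
    fix W' assume W': "W' \<in> shortest f"
    define W where "W = butlast W'"
    have W'eq: "W' = W @ [f]"
      using W' shortest_in_self W_def by (metis append_butlast_last_id)
    have "W \<noteq> []" using W' assms W'eq by (auto simp: shortest_singleton)
    then have W: "W \<in> shortest (last W)" "pre (last W) f"
      using W' W'eq shortest_snoc assms by auto
    moreover have "last W \<in> E" using W by (auto simp: shortest_def reachI reach_in_E)
    ultimately show "W' \<in> ?R" using W'eq by blast
  next
    fix W' assume "W' \<in> ?R"
    then obtain e W where "e \<in> E" "pre e f" "W \<in> shortest e" "W' = W @ [f]" by auto
    then show "W' \<in> shortest f" using shortest_snoc[of W f] shortest_in_self assms by metis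
  qed
  then have "count f = card ?R" by (simp only: count_def)
  also have "\<dots> = (\<Sum>e\<in>{e \<in> E. pre e f}. card ((\<lambda>W. W @ [f]) ` shortest e))"
  proof (intro card_UN_disjoint ballI impI)
    fix e e' :: "'v tedge" assume "e \<noteq> e'"
    then have "shortest e \<inter> shortest e' = {}" using shortest_in_self by blast
    then show "(\<lambda>W. W @ [f]) ` shortest e \<inter> (\<lambda>W. W @ [f]) ` shortest e' = {}" by auto
  qed simp_all
  also have "\<dots> = (\<Sum>e | e \<in> E \<and> pre e f. count e)"
    by (intro sum.cong) (auto simp: count_def card_image inj_on_def)
  finally show ?thesis .
qed

section \<open>Lexicographic optimality and final edges\<close>

lemma key_le_iff:
  assumes "reach e" "reach f"
  shows "key e \<le> key f \<longleftrightarrow> \<not> lex_less (arr f, dist f) (arr e, dist e)"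
proof -
  have less: "key a < key b" if "arr a < arr b" "reach a" for a b
  proof -
    \<comment> \<open>The distance stays below the base \<open>M + 3\<close>, so it cannot carry
      into the arrival time.\<close>
    have "key a < Suc (arr a) * (M + 3)" using dist_le_M[OF that(2)] by (simp add: key_def)
    also have "\<dots> \<le> arr b * (M + 3)" using that(1) by (intro mult_le_mono1) simp
    also have "\<dots> \<le> key b" by (simp add: key_def)
    finally show ?thesis .
  qed
  show ?thesis
    using less[of e f] less[of f e] assms
    by (cases "arr e" "arr f" rule: linorder_cases) (auto simp: lex_less_def key_def)
qed

text \<open>The lexicographic condition splits in two: walks with the same last edge have the same
  arrival time and compete by length only, while shortest walks to different last edges compete by
  \<open>key\<close> only.\<close>

lemma SFo_walk_iff:
  assumes "t \<noteq> s"
  shows "SFo_walk G s t W \<longleftrightarrow> W \<in> shortest (last W) \<and> final (last W) \<and> head (last W) = t"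
proof
  assume L: "SFo_walk G s t W"
  let ?e = "last W"
  have W: "swalk W" "head ?e = t"
    and min: "\<And>X. swalk X \<Longrightarrow> head (last X) = t \<Longrightarrow>
      \<not> lex_less (walk_arr X, length X) (walk_arr W, length W)"
    using L by (auto simp: SFo_walk_def walk_iff_swalk)
  have re: "reach ?e" using W reachI by auto
  have len: "length W = dist ?e"
  proof -
    obtain X where X: "X \<in> shortest ?e" using shortest_nonempty[OF re] by blast
    then have "\<not> length X < length W"
      using min[of X] W by (auto simp: shortest_def lex_less_def walk_arr_def)
    then show ?thesis using X dist_le[OF W(1)] by (auto simp: shortest_def)
  qed
  have "key ?e \<le> key f" if f: "reach f" "head f = head ?e" for f
  proof -
    obtain X where X: "X \<in> shortest f" using shortest_nonempty[OF f(1)] by blast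
    then show ?thesis
      using min[of X] W f re len
      by (auto simp: shortest_def walk_arr_def key_le_iff)
  qed
  then show "W \<in> shortest ?e \<and> final ?e \<and> head ?e = t"
    using W len re assms by (auto simp: shortest_def final_def)
next
  assume R: "W \<in> shortest (last W) \<and> final (last W) \<and> head (last W) = t"
  have "\<not> lex_less (walk_arr X, length X) (walk_arr W, length W)"
    if X: "swalk X" "head (last X) = t" for X
  proof -
    have "key (last W) \<le> key (last X)" using R X reachI[of X] unfolding final_def by metis
    then have "\<not> lex_less (arr (last X), dist (last X)) (arr (last W), dist (last W))"
      using key_le_iff R X reachI by (auto simp: final_def)
    then show ?thesis using dist_le[OF X(1)] R by (auto simp: lex_less_def walk_arr_def shortest_def)
  qed
  then show "SFo_walk G s t W"
    using R by (auto simp: SFo_walk_def walk_iff_swalk shortest_def)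
qed

lemma chi_iff: "chi G s t = 1 \<longleftrightarrow> t \<noteq> s \<and> (\<exists>e. reach e \<and> head e = t)"
  unfolding chi_def walk_iff_swalk reach_def by auto

lemma final_chi: "final e \<Longrightarrow> chi G s (head e) = 1"
  unfolding chi_iff final_def by blast

lemma chi_final:
  assumes "chi G s t = 1" shows "\<exists>e. final e \<and> head e = t"
proof -
  have "finite {e. reach e \<and> head e = t}" by (rule finite_subset[OF _ finite_reach]) auto
  moreover have "{e. reach e \<and> head e = t} \<noteq> {}" using assms chi_iff by auto
  ultimately obtain e where "is_arg_min key (\<lambda>e. e \<in> {e. reach e \<and> head e = t}) e"
    using ex_is_arg_min_if_finite by blast
  then have "final e \<and> head e = t"
    using assms chi_iff by (auto simp: is_arg_min_linorder final_def)
  then show ?thesis by blast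
qed

lemma finite_final [simp]: "finite {e. final e}"
  by (rule finite_subset[OF _ finite_reach]) (auto simp: final_reach)

text \<open>Guarantees that the quotients by \<open>total\<close> in the betweenness are genuine and
  not divisions by 0.\<close>

lemma total_pos:
  assumes "chi G s t = 1" shows "0 < total t"
proof -
  obtain e where e: "final e" "head e = t" using chi_final[OF assms] by blast
  have "finite {e. final e \<and> head e = t}" by (rule finite_subset[OF _ finite_final]) auto
  moreover have "0 < count e" using e final_reach count_pos_iff by simp
  ultimately show ?thesis
    unfolding total_def using e
    by (intro sum_pos2[of _ e]) auto
qed

section \<open>Completions and the betweenness of edges\<close>

lemma pre_imp_link: "successively pre W \<Longrightarrow> successively link W"
  by (erule successively_mono) (simp add: pre_def)

lemma finite_completions [simp]:
  "finite (completions t e)"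
proof (rule finite_subset)
  show "completions t e \<subseteq> {Q. set Q \<subseteq> E \<and> length Q \<le> M}"
  proof safe
    fix Q assume Q: "Q \<in> completions t e"
    then have "set Q \<subseteq> E" "successively link Q"
      using pre_imp_link[of "e # Q"] by (auto simp: completions_def successively_Cons)
    then show "length Q \<le> M" using distinct_links[of Q]
      by (metis card_mono distinct_card finite_E)
  qed (auto simp: completions_def)
qed (simp add: finite_lists_length_le)

text \<open>Decomposition by the first edge, dual to the decomposition by the last edge in
  \<open>count_step\<close>: walks to \<open>e\<close> are counted forwards from the source,
  completions backwards from the targets.\<close>

lemma completions_step:
  "completions t e = (if final e \<and> head e = t then {[]} else {}) \<union>
     (\<Union>f\<in>{f \<in> E. pre e f}. (#) f ` completions t f)" (is "?L = ?R")
proof (intro set_eqI iffI)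
  fix Q assume "Q \<in> ?L"
  then show "Q \<in> ?R"
    by (cases Q) (auto simp: completions_def split: if_splits)
next
  fix Q assume "Q \<in> ?R"
  then show "Q \<in> ?L"
    by (cases Q) (auto simp: completions_def split: if_splits)
qed

lemma card_completions:
  "card (completions t e) = (if final e \<and> head e = t then 1 else 0) +
     (\<Sum>f | f \<in> E \<and> pre e f. card (completions t f))"
proof -
  let ?U = "\<Union>f\<in>{f \<in> E. pre e f}. (#) f ` completions t f"
  let ?I = "if final e \<and> head e = t then {[]} else {} :: 'v tedge list set"
  have "card (completions t e) = card (?I \<union> ?U)"
    by (subst completions_step) simp
  also have "\<dots> = card ?I + card ?U"
    by (rule card_Un_disjoint) (auto split: if_splits)
  also have "card ?U = (\<Sum>f\<in>{f \<in> E. pre e f}. card ((#) f ` completions t f))"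
    by (rule card_UN_disjoint) auto
  also have "\<dots> = (\<Sum>f\<in>{f \<in> E. pre e f}. card (completions t f))"
    by (simp add: card_image)
  finally show ?thesis by simp
qed

text \<open>Cut an SFo walk right after \<open>e\<close>. Any shortest walk to \<open>e\<close> may
  be combined with any completion, because shortness and finality of the whole are decided along
  \<open>e # Q\<close>.\<close>

lemma sigma_edge_eq:
  assumes "e \<in> E" "t \<noteq> s"
  shows "sigma_edge G s e t = count e * card (completions t e)"
proof -
  let ?f = "\<lambda>(P, Q). P @ Q"
  have inj: "inj_on ?f (shortest e \<times> completions t e)"
  proof (rule inj_onI, clarify)
    fix P Q P' Q'
    assume a: "P \<in> shortest e" "Q \<in> completions t e" "P' \<in> shortest e" "Q' \<in> completions t e"
      and eq: "P @ Q = P' @ Q'"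
    \<comment> \<open>All first parts have length \<open>dist e\<close>, so the position of the cut
      can be recovered from the concatenation.\<close>
    have "length P = length P'" using a by (simp add: shortest_def)
    then show "P = P' \<and> Q = Q'" using eq by simp
  qed
  have "{W. SFo_walk G s t W \<and> e \<in> set W} = ?f ` (shortest e \<times> completions t e)"
  proof (intro set_eqI iffI)
    fix W assume "W \<in> {W. SFo_walk G s t W \<and> e \<in> set W}"
    then have W: "W \<in> shortest (last W)" "final (last W)" "head (last W) = t" and eW: "e \<in> set W"
      using SFo_walk_iff assms by auto
    obtain P0 Q where PQ: "W = P0 @ e # Q" using split_list[OF eW] by blast
    let ?P = "P0 @ [e]"
    have "swalk W" using W by (simp add: shortest_def)
    then have Qs: "set Q \<subseteq> E" using PQ by (auto simp: swalk_def)
    \<comment> \<open>Edges are peeled off the end by \<open>shortest_snoc\<close> until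
      \<open>e\<close> is the last one; each removed edge contributes one link of the
      \<open>pre\<close> chain.\<close>
    have "?P \<in> shortest e \<and> successively pre (e # Q)"
      using W(1) Qs unfolding PQ
    proof (induction Q rule: rev_induct)
      case Nil
      then show ?case by simp
    next
      case (snoc f Q)
      have l: "last (P0 @ e # Q) = last (e # Q)" by simp
      have "(P0 @ e # Q) @ [f] \<in> shortest f" using snoc.prems by simp
      then have st: "P0 @ e # Q \<in> shortest (last (e # Q)) \<and> pre (last (e # Q)) f"
        using shortest_snoc[of "P0 @ e # Q" f] snoc.prems l by simp
      then have "P0 @ [e] \<in> shortest e \<and> successively pre (e # Q)"
        using snoc l by simp
      moreover have "successively pre (e # Q @ [f])"
        using st calculation successively_append_iff[of pre "e # Q" "[f]"] by simp
      ultimately show ?case by simp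
    qed
    moreover have "last W = last (e # Q)" using PQ by simp
    ultimately have "?P \<in> shortest e" "Q \<in> completions t e"
      using W Qs by (auto simp: completions_def)
    then show "W \<in> ?f ` (shortest e \<times> completions t e)"
      using PQ by (intro image_eqI[of _ _ "(?P, Q)"]) auto
  next
    fix W assume "W \<in> ?f ` (shortest e \<times> completions t e)"
    then obtain P Q where PQ: "W = P @ Q" "P \<in> shortest e" "Q \<in> completions t e" by auto
    have "last W = last (e # Q)" "e \<in> set W"
      using PQ(1) shortest_in_self[OF PQ(2)] by auto
    then show "W \<in> {W. SFo_walk G s t W \<and> e \<in> set W}"
      using PQ shortest_append[OF PQ(2)] assms by (auto simp: SFo_walk_iff completions_def)
  qed
  then show ?thesis
    by (simp add: sigma_edge_def card_image[OF inj] card_cartesian_product count_def)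
qed

text \<open>If an SFo walk to \<open>t\<close> went on after an edge with head \<open>t\<close>, its
  prefix up to that edge would already be a walk to \<open>t\<close> with a strictly earlier
  arrival.\<close>

lemma sigma_edge_head:
  assumes "head e = t" "t \<noteq> s"
  shows "sigma_edge G s e t = (if final e then count e else 0)"
proof -
  have lastW: "last W = e" if W: "SFo_walk G s t W" "e \<in> set W" for W
  proof (rule ccontr)
    assume ne: "last W \<noteq> e"
    obtain P0 Q where PQ: "W = P0 @ e # Q" using split_list[OF W(2)] by blast
    have sw: "swalk W" and min: "\<And>X. walk G s t X \<Longrightarrow>
        \<not> lex_less (walk_arr X, length X) (walk_arr W, length W)"
      using W by (auto simp: SFo_walk_def walk_iff_swalk)
    have Q: "Q \<noteq> []" using ne PQ by auto
    have "successively link ((P0 @ [e]) @ Q)" using sw PQ by (simp add: swalk_def)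
    then have "successively link (P0 @ [e])" unfolding successively_append_iff by blast
    moreover have "hd (P0 @ [e]) = hd W" unfolding PQ by (cases P0) simp_all
    ultimately have "swalk (P0 @ [e])"
      using sw PQ by (simp add: swalk_def)
    moreover have "arr e < arr (last W)"
    proof -
      have "sorted_wrt (\<lambda>e f. arr e < arr f) W" using sw sorted_links by (auto simp: swalk_def)
      then show ?thesis using PQ Q by (simp add: sorted_wrt_append)
    qed
    ultimately show False
      using min[of "P0 @ [e]"] assms(1) by (simp add: walk_iff_swalk lex_less_def walk_arr_def)
  qed
  have "SFo_walk G s t W \<and> e \<in> set W \<longleftrightarrow> final e \<and> W \<in> shortest e" for W
  proof
    assume W: "SFo_walk G s t W \<and> e \<in> set W"
    then have "last W = e" using lastW by blast
    then show "final e \<and> W \<in> shortest e" using W SFo_walk_iff[OF assms(2)] by metis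
  next
    assume W: "final e \<and> W \<in> shortest e"
    then have "last W = e" "W \<noteq> []" using shortest_in_self by blast+
    then show "SFo_walk G s t W \<and> e \<in> set W"
      using W SFo_walk_iff[OF assms(2)] assms(1) last_in_set by metis
  qed
  then have "{W. SFo_walk G s t W \<and> e \<in> set W} = (if final e then shortest e else {})"
    by simp
  then show ?thesis by (simp add: sigma_edge_def count_def)
qed

lemma sigma_eq:
  assumes "t \<noteq> s" shows "sigma G s t = total t"
proof -
  have "sigma G s t = (\<Sum>e\<in>in_edges G t. if final e then count e else 0)"
    unfolding sigma_def using assms
    by (intro sum.cong) (auto simp: sigma_edge_head in_edges_def)
  also have "\<dots> = (\<Sum>e\<in>{e \<in> in_edges G t. final e}. count e)"
    by (rule sum.inter_filter[symmetric]) (simp add: in_edges_def)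
  also have "{e \<in> in_edges G t. final e} = {e. final e \<and> head e = t}"
    using final_reach reach_in_E by (auto simp: in_edges_def)
  finally show ?thesis by (simp add: total_def)
qed

lemma edge_betweenness_eq:
  assumes "e \<in> E"
  shows "edge_betweenness G s e = of_nat (count e) * delta e"
  unfolding edge_betweenness_def delta_def sum_distrib_left
proof (intro sum.cong refl)
  fix t assume "t \<in> {t \<in> verts G. chi G s t = 1}"
  then have "t \<noteq> s" using chi_iff by blast
  then show "of_nat (sigma_edge G s e t) / of_nat (sigma G s t) =
      of_nat (count e) * (of_nat (card (completions t e)) / of_nat (total t) :: rat)"
    using assms by (simp add: sigma_edge_eq sigma_eq)
qed

section \<open>The backward recurrence and the betweenness of nodes\<close>

lemma delta_step:
  "delta e = succ_delta e + (if final e then 1 / of_nat (total (head e)) else 0)"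
proof -
  let ?V = "{t. t \<in> verts G \<and> chi G s t = 1}"
  have "delta e = (\<Sum>t\<in>?V. (if final e \<and> head e = t then 1 / of_nat (total t) else 0) +
     (\<Sum>f | f \<in> E \<and> pre e f. of_nat (card (completions t f)) / of_nat (total t)))"
    unfolding delta_def
    by (intro sum.cong refl) (subst card_completions, auto simp: add_divide_distrib sum_divide_distrib)
  also have "\<dots> = (\<Sum>t\<in>?V. if final e \<and> head e = t then 1 / of_nat (total t) else 0) + succ_delta e"
    unfolding succ_delta_def delta_def sum.distrib by (subst sum.swap[of _ _ ?V]) simp
  \<comment> \<open>The empty completion counts for the single target \<open>head e\<close>, and
    \<open>final_chi\<close> puts it among the targets summed over.\<close>
  also have "(\<Sum>t\<in>?V. if final e \<and> head e = t then 1 / of_nat (total t) else (0 :: rat)) =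
      (if final e then 1 / of_nat (total (head e)) else 0)"
  proof (cases "final e")
    case True
    then have "head e \<in> ?V" using final_chi head_in_verts final_reach reach_in_E by auto
    then show ?thesis using True by simp
  qed simp
  finally show ?thesis by simp
qed

text \<open>The final-edge terms at \<open>u\<close> add up to the summand for the target
  \<open>t = u\<close>. That summand is 1 when \<open>u\<close> is a target, since every SFo walk to
  \<open>u\<close> has exactly one edge into \<open>u\<close>.\<close>

lemma sum_final_count:
  assumes "u \<noteq> s"
  shows "(\<Sum>e\<in>in_edges G u. of_nat (count e) * (if final e then 1 / of_nat (total (head e)) else 0))
    = (of_nat (chi G s u) :: rat)"
proof -
  have "(\<Sum>e\<in>in_edges G u. of_nat (count e) * (if final e then 1 / of_nat (total (head e)) else 0))
     = (\<Sum>e\<in>in_edges G u. if final e then of_nat (count e) / of_nat (total u) else (0 :: rat))"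
    by (intro sum.cong) (auto simp: in_edges_def)
  also have "\<dots> = (\<Sum>e\<in>{e \<in> in_edges G u. final e}. of_nat (count e) / of_nat (total u))"
    by (rule sum.inter_filter[symmetric]) (simp add: in_edges_def)
  also have "{e \<in> in_edges G u. final e} = {e. final e \<and> head e = u}"
    using final_reach reach_in_E by (auto simp: in_edges_def)
  also have "(\<Sum>e | final e \<and> head e = u. of_nat (count e) / of_nat (total u)) =
      (of_nat (total u) / of_nat (total u) :: rat)"
    by (simp only: total_def sum_divide_distrib of_nat_sum)
  also have "\<dots> = of_nat (chi G s u)"
  proof (cases "chi G s u = 1")
    case True
    then show ?thesis using total_pos by simp
  next
    case False
    then have "{e. final e \<and> head e = u} = {}" using final_chi by auto
    \<comment> \<open>Without final edges the quotient is \<open>0 / 0\<close>, which is 0 and thus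
      agrees with \<open>chi\<close>.\<close>
    then have "total u = 0" by (simp only: total_def sum.empty)
    moreover have "chi G s u = 0" using False by (auto simp: chi_def split: if_splits)
    ultimately show ?thesis by simp
  qed
  finally show ?thesis .
qed

text \<open>For \<open>s = u\<close> both sides vanish: the left sum is empty, and edges into
  \<open>s\<close> have no DAG successors because edges leaving \<open>s\<close> have distance 1.
  The program can therefore treat the source like any other node.\<close>

lemma sum_sigma_node:
  assumes "u \<in> verts G"
  shows "(\<Sum>t | t \<in> verts G - {u} \<and> s \<noteq> u \<and> chi G s t = 1.
        of_nat (sigma_node G s u t) / of_nat (sigma G s t)) =
    (\<Sum>e\<in>in_edges G u. of_nat (count e) * succ_delta e)"
proof (cases "s = u")
  case True
  have "succ_delta e = 0" if "e \<in> in_edges G u" for e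
  proof -
    have "{f \<in> E. pre e f} = {}"
    proof (rule ccontr)
      assume "{f \<in> E. pre e f} \<noteq> {}"
      then obtain f where f: "f \<in> E" "pre e f" by blast
      then have "head e = tail f" by (simp add: pre_def link_def)
      then have "tail f = s" using True that by (simp add: in_edges_def)
      then have "dist f = 1" using f dist_source by blast
      then show False using f dist_pos[of e] by (simp add: pre_def)
    qed
    then show ?thesis by (simp only: succ_delta_def sum.empty)
  qed
  then show ?thesis using True by simp
next
  case False
  let ?r = "\<lambda>t. of_nat (sigma_node G s u t) / of_nat (sigma G s t) :: rat"
  let ?V = "{t. t \<in> verts G \<and> chi G s t = 1}"
  have "(\<Sum>t\<in>?V. ?r t) = (\<Sum>t\<in>?V. \<Sum>e\<in>in_edges G u. of_nat (sigma_edge G s e t) / of_nat (sigma G s t))"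
    by (simp add: sigma_node_def sum_divide_distrib)
  also have "\<dots> = (\<Sum>e\<in>in_edges G u. edge_betweenness G s e)"
    unfolding edge_betweenness_def by (rule sum.swap)
  also have "\<dots> = (\<Sum>e\<in>in_edges G u. of_nat (count e) * delta e)"
    by (intro sum.cong) (auto simp: in_edges_def edge_betweenness_eq)
  also have "\<dots> = (\<Sum>e\<in>in_edges G u. of_nat (count e) * succ_delta e) + of_nat (chi G s u)"
    by (subst delta_step) (simp only: distrib_left sum.distrib sum_final_count[OF False[symmetric]])
  finally have all: "(\<Sum>t\<in>?V. ?r t) =
    (\<Sum>e\<in>in_edges G u. of_nat (count e) * succ_delta e) + of_nat (chi G s u)" .
  have V: "{t. t \<in> verts G - {u} \<and> s \<noteq> u \<and> chi G s t = 1} = ?V - {u}" using False by auto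
  have u: "?r u = 1" if "chi G s u = 1"
  proof -
    have "sigma_node G s u u = sigma G s u" by (simp add: sigma_node_def sigma_def)
    moreover have "sigma G s u > 0" using that total_pos sigma_eq False by simp
    ultimately show ?thesis by simp
  qed
  show ?thesis
  proof (cases "chi G s u = 1")
    case True
    then have "(\<Sum>t\<in>?V. ?r t) = ?r u + (\<Sum>t\<in>?V - {u}. ?r t)"
      using assms by (intro sum.remove) auto
    then show ?thesis using all u True V by simp
  next
    case False
    moreover have "chi G s u = 0" using False by (auto simp: chi_def split: if_splits)
    moreover have "?V - {u} = ?V" using False by auto
    ultimately show ?thesis using all V by simp
  qed
qed

end

lemma node_betweenness_eq:
  assumes "temporal_graph G" "max_wait G = \<infinity>" "u \<in> verts G"
  shows "node_betweenness G u =
    (\<Sum>s\<in>verts G. \<Sum>e\<in>in_edges G u. of_nat (sfo.count G s e) * sfo.succ_delta G s e)"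
proof -
  have fin: "finite (verts G)" using assms(1) by (simp add: temporal_graph_def)
  have "node_betweenness G u = (\<Sum>s\<in>verts G. \<Sum>t | t \<in> verts G - {u} \<and> s \<noteq> u \<and> chi G s t = 1.
        of_nat (sigma_node G s u t) / of_nat (sigma G s t))"
    unfolding node_betweenness_def using fin
    by (subst sum.Sigma) (auto intro!: sum.cong)
  also have "\<dots> = (\<Sum>s\<in>verts G. \<Sum>e\<in>in_edges G u. of_nat (sfo.count G s e) * sfo.succ_delta G s e)"
    by (intro sum.cong refl sfo.sum_sigma_node) (use assms in \<open>auto simp: sfo_def\<close>)
  finally show ?thesis .
qed

section \<open>Running programs\<close>

primrec loop_free :: "com \<Rightarrow> bool" where
  "loop_free Skip \<longleftrightarrow> True"
| "loop_free (NWrite x a b) \<longleftrightarrow> True"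
| "loop_free (QWrite x a q) \<longleftrightarrow> True"
| "loop_free (Seq c d) \<longleftrightarrow> loop_free c \<and> loop_free d"
| "loop_free (Cond b c d) \<longleftrightarrow> loop_free c \<and> loop_free d"
| "loop_free (While b c) \<longleftrightarrow> False"

text \<open>An equational semantics for loop-free programs: loop bodies are evaluated by rewriting,
  so \<open>exec\<close> has to be handled for loops only.\<close>

primrec run :: "com \<Rightarrow> store \<Rightarrow> store" where
  "run Skip \<sigma> = \<sigma>"
| "run (NWrite x a b) \<sigma> = nwrite x (nval a \<sigma>) (nval b \<sigma>) \<sigma>"
| "run (QWrite x a q) \<sigma> = qwrite x (nval a \<sigma>) (qval q \<sigma>) \<sigma>"
| "run (Seq c d) \<sigma> = run d (run c \<sigma>)"
| "run (Cond b c d) \<sigma> = (if bval b \<sigma> then run c \<sigma> else run d \<sigma>)"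
| "run (While b c) \<sigma> = \<sigma>"

text \<open>Adding the costs of both branches, rather than taking the maximum, keeps every bound a
  plain sum; for fixed programs the loss is a constant.\<close>

primrec bound :: "com \<Rightarrow> nat" where
  "bound Skip = 1"
| "bound (NWrite x a b) = ncost a + ncost b + 1"
| "bound (QWrite x a q) = ncost a + qcost q + 1"
| "bound (Seq c d) = bound c + bound d"
| "bound (Cond b c d) = bcost b + 1 + bound c + bound d"
| "bound (While b c) = 0"

primrec nwrites :: "com \<Rightarrow> string set" where
  "nwrites Skip = {}"
| "nwrites (NWrite x a b) = {x}"
| "nwrites (QWrite x a q) = {}"
| "nwrites (Seq c d) = nwrites c \<union> nwrites d"
| "nwrites (Cond b c d) = nwrites c \<union> nwrites d"
| "nwrites (While b c) = nwrites c"

primrec qwrites :: "com \<Rightarrow> string set" where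
  "qwrites Skip = {}"
| "qwrites (NWrite x a b) = {}"
| "qwrites (QWrite x a q) = {x}"
| "qwrites (Seq c d) = qwrites c \<union> qwrites d"
| "qwrites (Cond b c d) = qwrites c \<union> qwrites d"
| "qwrites (While b c) = qwrites c"

section \<open>Frame conditions and timed triples\<close>

lemma natmem_nwrite [simp]:
  "natmem (nwrite x i k \<sigma>) y = (if y = x then (natmem \<sigma> x)(i := k) else natmem \<sigma> y)"
  by (simp add: nwrite_def)

lemma ratmem_nwrite [simp]: "ratmem (nwrite x i k \<sigma>) = ratmem \<sigma>"
  by (simp add: nwrite_def)

lemma ratmem_qwrite [simp]:
  "ratmem (qwrite x i k \<sigma>) y = (if y = x then (ratmem \<sigma> x)(i := k) else ratmem \<sigma> y)"
  by (simp add: qwrite_def)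

lemma natmem_qwrite [simp]: "natmem (qwrite x i k \<sigma>) = natmem \<sigma>"
  by (simp add: qwrite_def)

text \<open>A purely syntactic frame condition. It lets loop invariants mention only the arrays that
  a pass changes.\<close>

definition unwritten_eq :: "com \<Rightarrow> store \<Rightarrow> store \<Rightarrow> bool" where
  "unwritten_eq c \<sigma> \<tau> \<longleftrightarrow> (\<forall>x. x \<notin> nwrites c \<longrightarrow> natmem \<tau> x = natmem \<sigma> x) \<and>
     (\<forall>x. x \<notin> qwrites c \<longrightarrow> ratmem \<tau> x = ratmem \<sigma> x)"

lemma unwritten_eqD:
  assumes "unwritten_eq c \<sigma> \<tau>"
  shows "x \<notin> nwrites c \<Longrightarrow> natmem \<tau> x = natmem \<sigma> x"
    and "x \<notin> qwrites c \<Longrightarrow> ratmem \<tau> x = ratmem \<sigma> x"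
  using assms by (auto simp: unwritten_eq_def)

lemma exec_unwritten_eq: "exec c \<sigma> T \<tau> \<Longrightarrow> unwritten_eq c \<sigma> \<tau>"
  by (induction rule: exec.induct) (auto simp: unwritten_eq_def)

text \<open>A total-correctness triple with time bound \<open>B\<close>. The initial store is a
  parameter instead of a precondition, so \<open>Q\<close> can refer to it.\<close>

definition runs :: "com \<Rightarrow> nat \<Rightarrow> store \<Rightarrow> (store \<Rightarrow> bool) \<Rightarrow> bool" where
  "runs c B \<sigma> Q \<longleftrightarrow> (\<exists>T \<tau>. exec c \<sigma> T \<tau> \<and> T \<le> B \<and> Q \<tau>)"

lemma runs_run:
  assumes "loop_free c" shows "runs c (bound c) \<sigma> (\<lambda>\<tau>. \<tau> = run c \<sigma>)"
proof -
  have "\<exists>T \<le> bound c. exec c \<sigma> T (run c \<sigma>)"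
    using assms
  proof (induction c arbitrary: \<sigma>)
    case Skip
    show ?case using exec_Skip by auto
  next
    case (NWrite x a b)
    show ?case using exec_NWrite by auto
  next
    case (QWrite x a q)
    show ?case using exec_QWrite by auto
  next
    case (Seq c d)
    then obtain T T' where "T \<le> bound c" "exec c \<sigma> T (run c \<sigma>)"
        "T' \<le> bound d" "exec d (run c \<sigma>) T' (run d (run c \<sigma>))"
      by (metis loop_free.simps(4))
    then show ?case by (intro exI[of _ "T + T'"]) (auto intro: exec_Seq)
  next
    case (Cond b c d)
    show ?case
    proof (cases "bval b \<sigma>")
      case True
      obtain T where "T \<le> bound c" "exec c \<sigma> T (run c \<sigma>)"
        using Cond by (metis loop_free.simps(5))
      then show ?thesis using True
        by (intro exI[of _ "bcost b + 1 + T"]) (use exec_CondT[of b \<sigma>] in simp)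
    next
      case False
      obtain T where "T \<le> bound d" "exec d \<sigma> T (run d \<sigma>)"
        using Cond by (metis loop_free.simps(5))
      then show ?thesis using False
        by (intro exI[of _ "bcost b + 1 + T"]) (use exec_CondF[of b \<sigma>] in simp)
    qed
  qed simp
  then show ?thesis by (auto simp: runs_def)
qed

lemma runs_mono:
  assumes "runs c B \<sigma> Q" "B \<le> B'" "\<And>\<tau>. unwritten_eq c \<sigma> \<tau> \<Longrightarrow> Q \<tau> \<Longrightarrow> R \<tau>"
  shows "runs c B' \<sigma> R"
  using assms exec_unwritten_eq unfolding runs_def by (meson le_trans)

lemma runs_Seq:
  assumes "runs c B \<sigma> Q" "\<And>\<tau>. unwritten_eq c \<sigma> \<tau> \<Longrightarrow> Q \<tau> \<Longrightarrow> runs d B' \<tau> R"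
  shows "runs (Seq c d) (B + B') \<sigma> R"
proof -
  obtain T \<tau> where 1: "exec c \<sigma> T \<tau>" "T \<le> B" "Q \<tau>" using assms(1) by (auto simp: runs_def)
  then have "runs d B' \<tau> R" using assms(2) exec_unwritten_eq by blast
  then obtain T' \<tau>' where "exec d \<tau> T' \<tau>'" "T' \<le> B'" "R \<tau>'" by (auto simp: runs_def)
  then show ?thesis using 1 exec_Seq unfolding runs_def by (meson add_mono)
qed

abbreviation Var :: "string \<Rightarrow> nexp" where
  "Var x \<equiv> NRead x (NConst 0)"

definition For :: "string \<Rightarrow> nexp \<Rightarrow> com \<Rightarrow> com" where
  "For x N c = Seq (NWrite x (NConst 0) (NConst 0))
     (While (NLess (Var x) N) (Seq c (NWrite x (NConst 0) (NAdd (Var x) (NConst 1)))))"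

lemma nwrites_For [simp]: "nwrites (For x N c) = insert x (nwrites c)"
  and qwrites_For [simp]: "qwrites (For x N c) = qwrites c"
  by (auto simp: For_def)

text \<open>The limit \<open>N\<close> is evaluated anew in every round, so its value must survive
  everything the loop writes. The constants 20 generously cover initialising, testing and
  incrementing the counter.\<close>

lemma runs_For:
  assumes x: "x \<notin> nwrites c"
    and N: "\<And>\<tau>. unwritten_eq (For x N c) \<sigma> \<tau> \<Longrightarrow> nval N \<tau> = m"
    and init: "I 0 (nwrite x 0 0 \<sigma>)"
    and step: "\<And>k \<tau>. k < m \<Longrightarrow> natmem \<tau> x 0 = k \<Longrightarrow> unwritten_eq (For x N c) \<sigma> \<tau> \<Longrightarrow> I k \<tau> \<Longrightarrow>
      runs c B \<tau> (\<lambda>\<tau>'. I (Suc k) (nwrite x 0 (Suc k) \<tau>'))"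
  shows "runs (For x N c) (m * (B + ncost N + 20) + ncost N + 20) \<sigma> (I m)"
proof -
  let ?b = "NLess (Var x) N"
  let ?c = "Seq c (NWrite x (NConst 0) (NAdd (Var x) (NConst 1)))"
  have loop: "runs (While ?b ?c) ((m - k) * (B + ncost N + 20) + ncost N + 10) \<tau> (I m)"
    if "k \<le> m" "natmem \<tau> x 0 = k" "unwritten_eq (For x N c) \<sigma> \<tau>" "I k \<tau>" for k \<tau>
    using that
  proof (induction "m - k" arbitrary: k \<tau>)
    case 0
    then have "\<not> bval ?b \<tau>" "k = m" using N by auto
    then show ?case
      using exec_WhileF[of ?b \<tau> ?c] 0 unfolding runs_def
      by (intro exI[of _ "bcost ?b + 1"] exI[of _ \<tau>]) simp
  next
    case (Suc d)
    then have km: "k < m" by simp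
    have b: "bval ?b \<tau>" using Suc km N by auto
    obtain T \<tau>1 where 1: "exec c \<tau> T \<tau>1" "T \<le> B" "I (Suc k) (nwrite x 0 (Suc k) \<tau>1)"
      using step[OF km] Suc.prems unfolding runs_def by metis
    let ?\<tau>2 = "nwrite x 0 (Suc k) \<tau>1"
    have u: "unwritten_eq c \<tau> \<tau>1" using exec_unwritten_eq 1 by blast
    then have "natmem \<tau>1 x 0 = k" using x Suc.prems by (simp add: unwritten_eq_def)
    then have "exec (NWrite x (NConst 0) (NAdd (Var x) (NConst 1))) \<tau>1 (1 + 4 + 1) ?\<tau>2"
      using exec_NWrite[of x "NConst 0" "NAdd (Var x) (NConst 1)" \<tau>1] by (simp add: numeral_eq_Suc)
    then have ec: "exec ?c \<tau> (T + (1 + 4 + 1)) ?\<tau>2" by (rule exec_Seq[OF 1(1)])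
    have "unwritten_eq (For x N c) \<sigma> ?\<tau>2"
      using u Suc.prems(3) by (auto simp: unwritten_eq_def)
    then have "runs (While ?b ?c) ((m - Suc k) * (B + ncost N + 20) + ncost N + 10) ?\<tau>2 (I m)"
      using Suc.hyps km 1(3) by (intro Suc.hyps(1)) auto
    then obtain T' \<tau>3 where 3: "exec (While ?b ?c) ?\<tau>2 T' \<tau>3"
        "T' \<le> (m - Suc k) * (B + ncost N + 20) + ncost N + 10" "I m \<tau>3"
      by (auto simp: runs_def)
    have "exec (While ?b ?c) \<tau> (bcost ?b + 1 + (T + (1 + 4 + 1)) + T') \<tau>3"
      by (rule exec_WhileT[OF b ec 3(1)])
    moreover have "bcost ?b + 1 + (T + (1 + 4 + 1)) + T' \<le>
        (m - k) * (B + ncost N + 20) + ncost N + 10"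
    proof -
      have "m - k = Suc (m - Suc k)" using km by simp
      then show ?thesis using 3(2) 1(2) by simp
    qed
    ultimately show ?case unfolding runs_def using 3(3) by blast
  qed
  have "runs (NWrite x (NConst 0) (NConst 0)) 3 \<sigma> (\<lambda>\<tau>. \<tau> = nwrite x 0 0 \<sigma>)"
    using runs_run[of "NWrite x (NConst 0) (NConst 0)" \<sigma>] by (simp add: numeral_eq_Suc)
  then have "runs (For x N c) (3 + ((m - 0) * (B + ncost N + 20) + ncost N + 10)) \<sigma> (I m)"
    unfolding For_def
  proof (rule runs_Seq)
    fix \<tau> assume "\<tau> = nwrite x 0 0 \<sigma>"
    then show "runs (While ?b ?c) ((m - 0) * (B + ncost N + 20) + ncost N + 10) \<tau> (I m)"
      using init by (intro loop) (auto simp: unwritten_eq_def)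
  qed
  then show ?thesis by (rule runs_mono) auto
qed

text \<open>The factor 2 stands for the two events of each edge. Costs are measured in multiples of
  \<open>Suc M\<close>, so that the overhead of a loop without rounds is covered as well.\<close>

definition loop_rate :: "nexp \<Rightarrow> com \<Rightarrow> nat" where
  "loop_rate N c = 2 * (bound c + ncost N + 20)"

lemma runs_For_run:
  assumes "loop_free c" "x \<notin> nwrites c" "m \<le> 2 * M"
    and "\<And>\<tau>. unwritten_eq (For x N c) \<sigma> \<tau> \<Longrightarrow> nval N \<tau> = m"
    and "I 0 (nwrite x 0 0 \<sigma>)"
    and step: "\<And>k \<tau>. k < m \<Longrightarrow> natmem \<tau> x 0 = k \<Longrightarrow> unwritten_eq (For x N c) \<sigma> \<tau> \<Longrightarrow> I k \<tau> \<Longrightarrow>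
      I (Suc k) (nwrite x 0 (Suc k) (run c \<tau>))"
  shows "runs (For x N c) (loop_rate N c * Suc M) \<sigma> (I m)"
proof -
  have "runs (For x N c) (m * (bound c + ncost N + 20) + ncost N + 20) \<sigma> (I m)"
    using assms by (intro runs_For) (auto intro: runs_mono[OF runs_run])
  moreover have "m * (bound c + ncost N + 20) + ncost N + 20 \<le> loop_rate N c * Suc M"
  proof -
    have "m * (bound c + ncost N + 20) \<le> 2 * M * (bound c + ncost N + 20)"
      using assms(3) by (rule mult_le_mono1)
    then show ?thesis by (simp add: loop_rate_def algebra_simps)
  qed
  ultimately show ?thesis by (rule runs_mono) auto
qed

section \<open>Addressing temporal edges\<close>

text \<open>A variant of Cantor pairing with squares for triangular numbers, as the machine cannot
  halve. The value lies between the squares of \<open>a + b\<close> and \<open>a + b + 1\<close>,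
  which determines \<open>a + b\<close> and then \<open>a\<close>.\<close>

definition pair :: "nat \<Rightarrow> nat \<Rightarrow> nat" where
  "pair a b = (a + b) * (a + b) + a"

lemma pair_eq_iff [simp]: "pair a b = pair c d \<longleftrightarrow> a = c \<and> b = d"
proof
  have less: "pair a b < pair c d" if "a + b < c + d" for a b c d
  proof -
    have "pair a b < Suc (a + b) * Suc (a + b)" by (simp add: pair_def)
    also have "\<dots> \<le> (c + d) * (c + d)" using that by (intro mult_le_mono) auto
    also have "\<dots> \<le> pair c d" by (simp add: pair_def)
    finally show ?thesis .
  qed
  assume eq: "pair a b = pair c d"
  then have "a + b = c + d" using less[of a b c d] less[of c d a b] by linarith
  then show "a = c \<and> b = d" using eq by (simp add: pair_def)
qed simp

text \<open>All four components enter, since edges may be parallel. Addresses become large, but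
  arrays are unbounded and arithmetic has unit cost.\<close>

definition code :: "nat tedge \<Rightarrow> nat" where
  "code e = pair (tail e) (pair (head e) (pair (dep e) (trav e)))"

lemma code_eq_iff [simp]: "code e = code f \<longleftrightarrow> e = f"
  by (cases e; cases f) (simp add: code_def)

definition NPair :: "nexp \<Rightarrow> nexp \<Rightarrow> nexp" where
  "NPair a b = NAdd (NMul (NAdd a b) (NAdd a b)) a"

lemma nval_NPair [simp]: "nval (NPair a b) \<sigma> = pair (nval a \<sigma>) (nval b \<sigma>)"
  by (simp add: NPair_def pair_def)

definition NCode :: "string \<Rightarrow> string \<Rightarrow> string \<Rightarrow> string \<Rightarrow> nexp \<Rightarrow> nexp" where
  "NCode xu xv xt xl a = NPair (NRead xu a) (NPair (NRead xv a) (NPair (NRead xt a) (NRead xl a)))"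

lemma nval_NCode:
  assumes "holds_edges \<sigma> xu xv xt xl es" "nval a \<sigma> < length es"
  shows "nval (NCode xu xv xt xl a) \<sigma> = code (es ! nval a \<sigma>)"
  using assms by (simp add: NCode_def code_def holds_edges_def)

section \<open>The list of events\<close>

text \<open>An event is a departure (\<open>False\<close>) or an arrival (\<open>True\<close>) of a temporal edge; at equal times
  arrivals come first.\<close>

fun events :: "'v tedge list \<Rightarrow> 'v tedge list \<Rightarrow> (bool \<times> 'v tedge) list" where
  "events [] [] = []"
| "events (d # ds) [] = (False, d) # events ds []"
| "events [] (a # as) = (True, a) # events [] as"
| "events (d # ds) (a # as) =
     (if dep d < arr a then (False, d) # events ds (a # as) else (True, a) # events (d # ds) as)"

lemma length_events: "length (events ds as) = length ds + length as"
  by (induction ds as rule: events.induct) auto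

lemma set_events: "set (events ds as) = Pair False ` set ds \<union> Pair True ` set as"
  by (induction ds as rule: events.induct) auto

lemma distinct_events: "distinct ds \<Longrightarrow> distinct as \<Longrightarrow> distinct (events ds as)"
  by (induction ds as rule: events.induct) (auto simp: set_events)

text \<open>Only events of different kinds need comparing. Ties go to arrivals because an edge may
  be continued at the very moment of its arrival.\<close>

definition event_order :: "bool \<times> 'v tedge \<Rightarrow> bool \<times> 'v tedge \<Rightarrow> bool" where
  "event_order x y \<longleftrightarrow> (fst x \<and> \<not> fst y \<longrightarrow> arr (snd x) \<le> dep (snd y)) \<and>
     (\<not> fst x \<and> fst y \<longrightarrow> dep (snd x) < arr (snd y))"

lemma sorted_events:
  "sorted (map dep ds) \<Longrightarrow> sorted (map arr as) \<Longrightarrow> sorted_wrt event_order (events ds as)"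
proof (induction ds as rule: events.induct)
  case (4 d ds a as)
  have d: "\<forall>f\<in>set ds. dep d \<le> dep f" and a: "\<forall>f\<in>set as. arr a \<le> arr f"
    using "4.prems" by auto
  show ?case
  proof (cases "dep d < arr a")
    case True
    have "event_order (False, d) x" if "x \<in> set (events ds (a # as))" for x
      using that a True by (auto simp: set_events event_order_def intro: less_le_trans)
    then show ?thesis using True "4.IH"(1) "4.prems" by simp
  next
    case False
    have "event_order (True, a) x" if "x \<in> set (events (d # ds) as)" for x
      using that d False by (auto simp: set_events event_order_def not_less intro: order_trans)
    then show ?thesis using False "4.IH"(2) "4.prems" by simp
  qed
qed (auto simp: set_events event_order_def)

section \<open>The program\<close>

definition store_event :: "nat \<Rightarrow> string \<Rightarrow> string \<Rightarrow> string \<Rightarrow> string \<Rightarrow> nexp \<Rightarrow> com" where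
  "store_event b xu xv xt xl a =
     Seq (NWrite ''ev_kind'' (Var ''k'') (NConst b))
    (Seq (NWrite ''ev_tail'' (Var ''k'') (NRead xu a))
    (Seq (NWrite ''ev_head'' (Var ''k'') (NRead xv a))
    (Seq (NWrite ''ev_arr'' (Var ''k'') (NAdd (NRead xt a) (NRead xl a)))
         (NWrite ''ev_code'' (Var ''k'') (NCode xu xv xt xl a)))))"

text \<open>A departure comes next if arrivals are exhausted or it is strictly earlier; the
  implication is spelled with \<open>BNot\<close> and \<open>BAnd\<close>. Comparing cells past the
  end of a list is harmless, as every cell has a value and the guards decide.\<close>

definition departure_next :: bexp where
  "departure_next = BAnd (NLess (Var ''i'') (Var ''M''))
     (BNot (BAnd (NLess (Var ''j'') (Var ''M''))
       (BNot (NLess (NRead ''dep_dep'' (Var ''i''))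
         (NAdd (NRead ''arr_dep'' (Var ''j'')) (NRead ''arr_trav'' (Var ''j'')))))))"

definition merge_body :: com where
  "merge_body = Cond departure_next
     (Seq (store_event 0 ''dep_tail'' ''dep_head'' ''dep_dep'' ''dep_trav'' (Var ''i''))
          (NWrite ''i'' (NConst 0) (NAdd (Var ''i'') (NConst 1))))
     (Seq (store_event 1 ''arr_tail'' ''arr_head'' ''arr_dep'' ''arr_trav'' (Var ''j''))
          (NWrite ''j'' (NConst 0) (NAdd (Var ''j'') (NConst 1))))"

definition MM :: nexp where
  "MM = NAdd (Var ''M'') (Var ''M'')"

abbreviation edist :: "nexp \<Rightarrow> nexp" where
  "edist a \<equiv> NRead ''dist'' (NRead ''ev_code'' a)"

abbreviation ecount :: "nexp \<Rightarrow> nexp" where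
  "ecount a \<equiv> NRead ''count'' (NRead ''ev_code'' a)"

abbreviation etail :: "nexp \<Rightarrow> nexp" where
  "etail a \<equiv> NRead ''ev_tail'' a"

abbreviation ehead :: "nexp \<Rightarrow> nexp" where
  "ehead a \<equiv> NRead ''ev_head'' a"

definition ekey :: "nexp \<Rightarrow> nexp" where
  "ekey a = NAdd (NMul (NRead ''ev_arr'' a) (NAdd (Var ''M'') (NConst 3))) (edist a)"

definition ereach :: "nexp \<Rightarrow> bexp" where
  "ereach a = NLess (edist a) (NAdd (Var ''M'') (NConst 1))"

definition efinal :: "nexp \<Rightarrow> bexp" where
  "efinal a = BAnd (ereach a) (BAnd (BNot (NEq (ehead a) (Var ''source'')))
     (NEq (ekey a) (NRead ''key'' (ehead a))))"

text \<open>Initialises only endpoints of edges: a pass over all nodes would exceed O(M) when many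
  nodes are isolated. The value \<open>M + 1\<close> means that nothing has arrived.\<close>

definition init_body :: com where
  "init_body =
     Seq (NWrite ''D'' (etail (Var ''k'')) (NAdd (Var ''M'') (NConst 1)))
    (Seq (NWrite ''D'' (ehead (Var ''k'')) (NAdd (Var ''M'') (NConst 1)))
    (Seq (NWrite ''C'' (etail (Var ''k'')) (NConst 0))
         (NWrite ''C'' (ehead (Var ''k'')) (NConst 0))))"

text \<open>One empty walk at the source makes the edges leaving \<open>s\<close> obey the general departure rule.\<close>

definition init_source :: com where
  "init_source = Seq (NWrite ''D'' (Var ''source'') (NConst 0))
     (NWrite ''C'' (Var ''source'') (NConst 1))"

text \<open>On a strict improvement the count is reset to 0 and the distance lowered, so the
  equality test that follows serves improvements and ties alike. Unreached edges
  (\<open>M + 2\<close>) and arrivals at \<open>s\<close> (where \<open>D\<close> is 0) pass both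
  tests without effect.\<close>

definition forward_body :: com where
  "forward_body = Cond (NEq (NRead ''ev_kind'' (Var ''k'')) (NConst 0))
     (Seq (NWrite ''dist'' (NRead ''ev_code'' (Var ''k'')) (NAdd (NRead ''D'' (etail (Var ''k''))) (NConst 1)))
          (NWrite ''count'' (NRead ''ev_code'' (Var ''k'')) (NRead ''C'' (etail (Var ''k'')))))
     (Seq (Cond (NLess (edist (Var ''k'')) (NRead ''D'' (ehead (Var ''k''))))
            (Seq (NWrite ''D'' (ehead (Var ''k'')) (edist (Var ''k'')))
                 (NWrite ''C'' (ehead (Var ''k'')) (NConst 0)))
            Skip)
          (Cond (NEq (edist (Var ''k'')) (NRead ''D'' (ehead (Var ''k''))))
            (NWrite ''C'' (ehead (Var ''k'')) (NAdd (NRead ''C'' (ehead (Var ''k''))) (ecount (Var ''k''))))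
            Skip))"

text \<open>Since memory is not initially zero and scanning all addresses is impossible, exactly the cells used
  later are cleared. Each \<open>key\<close> cell receives some attained value, so that the subsequent minimum
  computation needs no infinity.\<close>

definition clear_body :: com where
  "clear_body =
     Seq (Cond (ereach (Var ''k'')) (NWrite ''key'' (ehead (Var ''k'')) (ekey (Var ''k''))) Skip)
    (Seq (NWrite ''total'' (ehead (Var ''k'')) (NConst 0))
    (Seq (QWrite ''flow'' (NPair (ehead (Var ''k'')) (NAdd (edist (Var ''k'')) (NConst 1))) (QOf (NConst 0)))
         (QWrite ''flow'' (NPair (etail (Var ''k'')) (edist (Var ''k''))) (QOf (NConst 0)))))"

definition key_body :: com where
  "key_body = Cond (BAnd (ereach (Var ''k'')) (NLess (ekey (Var ''k'')) (NRead ''key'' (ehead (Var ''k'')))))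
     (NWrite ''key'' (ehead (Var ''k'')) (ekey (Var ''k''))) Skip"

text \<open>Each edge occurs as two events. Clearing and minimising are insensitive to the
  repetition, but a sum is not, hence the restriction to arrivals.\<close>

definition total_body :: com where
  "total_body = Cond (BAnd (NEq (NRead ''ev_kind'' (Var ''k'')) (NConst 1)) (efinal (Var ''k'')))
     (NWrite ''total'' (ehead (Var ''k'')) (NAdd (NRead ''total'' (ehead (Var ''k''))) (ecount (Var ''k''))))
     Skip"

text \<open>The \<open>flow\<close> cell at \<open>(v, d)\<close> collects \<open>delta\<close> of
  the edges leaving \<open>v\<close> with distance \<open>d\<close> whose departure has been passed;
  looking up \<open>(head e, dist e + 1)\<close> selects exactly the successors of \<open>e\<close>.
  The \<open>delta\<close> cell first holds \<open>succ_delta e\<close>, which is credited to the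
  node before the final-edge term is added.\<close>

definition backward_body :: com where
  "backward_body = Seq (NWrite ''q'' (NConst 0) (NSub (NSub MM (NConst 1)) (Var ''k'')))
    (Cond (NEq (NRead ''ev_kind'' (Var ''q'')) (NConst 0))
      (QWrite ''flow'' (NPair (etail (Var ''q'')) (edist (Var ''q'')))
        (QAdd (QRead ''flow'' (NPair (etail (Var ''q'')) (edist (Var ''q''))))
              (QRead ''delta'' (NRead ''ev_code'' (Var ''q'')))))
      (Seq (QWrite ''delta'' (NRead ''ev_code'' (Var ''q''))
             (QRead ''flow'' (NPair (ehead (Var ''q'')) (NAdd (edist (Var ''q'')) (NConst 1)))))
      (Seq (QWrite ''node_betweenness'' (ehead (Var ''q''))
             (QAdd (QRead ''node_betweenness'' (ehead (Var ''q'')))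
                   (QMul (QOf (ecount (Var ''q''))) (QRead ''delta'' (NRead ''ev_code'' (Var ''q''))))))
           (Cond (efinal (Var ''q''))
             (QWrite ''delta'' (NRead ''ev_code'' (Var ''q''))
               (QAdd (QRead ''delta'' (NRead ''ev_code'' (Var ''q'')))
                     (QDiv (QOf (NConst 1)) (QOf (NRead ''total'' (ehead (Var ''q'')))))))
             Skip))))"

definition output_body :: com where
  "output_body = QWrite ''edge_betweenness'' (Var ''k'')
     (QMul (QOf (NRead ''count'' (NCode ''arr_tail'' ''arr_head'' ''arr_dep'' ''arr_trav'' (Var ''k''))))
           (QRead ''delta'' (NCode ''arr_tail'' ''arr_head'' ''arr_dep'' ''arr_trav'' (Var ''k''))))"

definition merge_prog :: com where
  "merge_prog = Seq (Seq (NWrite ''i'' (NConst 0) (NConst 0)) (NWrite ''j'' (NConst 0) (NConst 0)))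
     (For ''k'' MM merge_body)"

definition forward_prog :: com where
  "forward_prog = Seq (For ''k'' MM init_body) (Seq init_source (For ''k'' MM forward_body))"

definition weight_prog :: com where
  "weight_prog = Seq (For ''k'' MM clear_body) (Seq (For ''k'' MM key_body) (For ''k'' MM total_body))"

definition finish_prog :: com where
  "finish_prog = Seq (For ''k'' MM backward_body) (For ''k'' (Var ''M'') output_body)"

definition source_prog :: com where
  "source_prog = Seq merge_prog (Seq forward_prog (Seq weight_prog finish_prog))"

text \<open>The \<open>6\<close> pays for setting \<open>i\<close> and \<open>j\<close> to 0 before
  merging.\<close>

definition source_rate :: nat where
  "source_rate = (6 + loop_rate MM merge_body) +
     (loop_rate MM init_body + bound init_source + loop_rate MM forward_body) +
     (loop_rate MM clear_body + loop_rate MM key_body + loop_rate MM total_body) +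
     (loop_rate MM backward_body + loop_rate (Var ''M'') output_body)"

definition source_body :: com where
  "source_body = Seq (NWrite ''source'' (NConst 0) (NRead ''node'' (Var ''h''))) source_prog"

definition zero_body :: com where
  "zero_body = QWrite ''node_betweenness'' (NRead ''node'' (Var ''h'')) (QOf (NConst 0))"

text \<open>The pass for a source adds to \<open>node_betweenness\<close> instead of overwriting it,
  so the results of all sources accumulate; the array must be zeroed once beforehand.\<close>

definition node_prog :: com where
  "node_prog = Seq (For ''h'' (Var ''n'') zero_body) (For ''h'' (Var ''n'') source_body)"

lemmas body_defs = store_event_def departure_next_def merge_body_def init_body_def init_source_def
  forward_body_def clear_body_def key_body_def total_body_def backward_body_def output_body_def

section \<open>Positions in the event list\<close>

locale sfo_input = sfo G s for G :: "nat tgraph" and s +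
  fixes Earr Edep :: "nat tedge list"
  assumes doubly_sorted: "doubly_sorted G Earr Edep"
begin

definition EV :: "(bool \<times> nat tedge) list" where
  "EV = events Edep Earr"

lemma length_Earr [simp]: "length Earr = M" and length_Edep [simp]: "length Edep = M"
  using doubly_sorted distinct_card[of Earr] distinct_card[of Edep] by (auto simp: doubly_sorted_def)

lemma length_EV [simp]: "length EV = 2 * M"
  by (simp add: EV_def length_events)

lemma set_EV: "set EV = UNIV \<times> E"
  using doubly_sorted by (auto simp: EV_def set_events doubly_sorted_def)

lemma distinct_EV: "distinct EV"
  using doubly_sorted by (simp add: EV_def distinct_events doubly_sorted_def)

lemma sorted_EV: "sorted_wrt event_order EV"
  using doubly_sorted by (simp add: EV_def sorted_events doubly_sorted_def)

definition before :: "bool \<Rightarrow> nat \<Rightarrow> nat tedge set" where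
  "before b k = {e. (b, e) \<in> set (take k EV)}"

definition after :: "bool \<Rightarrow> nat \<Rightarrow> nat tedge set" where
  "after b k = {e. (b, e) \<in> set (drop k EV)}"

lemma before_0 [simp]: "before b 0 = {}" and before_all: "before b (2 * M) = E"
  and after_0: "after b 0 = E" and after_all [simp]: "after b (2 * M) = {}"
  by (auto simp: before_def after_def set_EV)

lemma before_subset: "before b k \<subseteq> E"
  using set_take_subset[of k EV] by (auto simp: before_def set_EV)

lemma after_subset: "after b k \<subseteq> E"
  using set_drop_subset[of k EV] by (auto simp: after_def set_EV)

lemma finite_before [simp]: "finite (before b k)" and finite_after [simp]: "finite (after b k)"
  using before_subset after_subset finite_E by (meson finite_subset)+

context
  fixes k c e assumes k: "k < 2 * M" and event: "EV ! k = (c, e)"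
begin

lemma event_edge: "e \<in> E"
  using k event nth_mem[of k EV] set_EV by auto

lemma EV_split: "EV = take k EV @ (c, e) # drop (Suc k) EV"
  using k event id_take_nth_drop[of k EV] by simp

lemma before_Suc: "before b (Suc k) = (if b = c then insert e (before b k) else before b k)"
  using k event by (auto simp: before_def take_Suc_conv_app_nth)

lemma after_step: "after b k = (if b = c then insert e (after b (Suc k)) else after b (Suc k))"
  using k event Cons_nth_drop_Suc[of k EV, symmetric] by (auto simp: after_def)

lemma event_orders:
  "\<forall>x\<in>set (take k EV). event_order x (c, e)" "\<forall>x\<in>set (drop (Suc k) EV). event_order (c, e) x"
  "(c, e) \<notin> set (take k EV)" "(c, e) \<notin> set (drop (Suc k) EV)"
  "x \<in> set EV \<Longrightarrow> x \<noteq> (c, e) \<Longrightarrow> x \<in> set (take k EV) \<or> x \<in> set (drop (Suc k) EV)"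
proof -
  have "sorted_wrt event_order (take k EV @ (c, e) # drop (Suc k) EV)"
    using sorted_EV by (simp only: EV_split[symmetric])
  then show "\<forall>x\<in>set (take k EV). event_order x (c, e)" "\<forall>x\<in>set (drop (Suc k) EV). event_order (c, e) x"
    unfolding sorted_wrt_append by simp_all
  have "distinct (take k EV @ (c, e) # drop (Suc k) EV)"
    using distinct_EV by (simp only: EV_split[symmetric])
  then show "(c, e) \<notin> set (take k EV)" "(c, e) \<notin> set (drop (Suc k) EV)"
    unfolding distinct_append by simp_all
  have "set EV = set (take k EV @ (c, e) # drop (Suc k) EV)"
    by (simp only: EV_split[symmetric])
  then show "x \<in> set EV \<Longrightarrow> x \<noteq> (c, e) \<Longrightarrow> x \<in> set (take k EV) \<or> x \<in> set (drop (Suc k) EV)"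
    by simp
qed

lemma event_not_before: "e \<notin> before c k" and event_not_after: "e \<notin> after c (Suc k)"
  using event_orders by (auto simp: before_def after_def)

text \<open>An equality and not just an inclusion, thanks to the rule for ties. With it, the running
  values at the tail of \<open>e\<close> range over exactly the edges that can precede
  \<open>e\<close>.\<close>

lemma arrived_before_departure: "\<not> c \<Longrightarrow> before True k = {f \<in> E. arr f \<le> dep e}"
proof (intro set_eqI iffI)
  fix f assume c: "\<not> c" and "f \<in> before True k"
  then show "f \<in> {f \<in> E. arr f \<le> dep e}"
    using before_subset event_orders(1) by (fastforce simp: before_def event_order_def)
next
  fix f assume c: "\<not> c" and f: "f \<in> {f \<in> E. arr f \<le> dep e}"
  have "(True, f) \<in> set EV" "(True, f) \<noteq> (c, e)" using c f set_EV by auto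
  moreover have "(True, f) \<notin> set (drop (Suc k) EV)"
    using f c event_orders(2) by (fastforce simp: event_order_def)
  ultimately show "f \<in> before True k" using event_orders(5) unfolding before_def by blast
qed

text \<open>By positive travel time, the distance and count fixed at the departure of an edge are
  available when its arrival is processed.\<close>

lemma departed_before_arrival:
  assumes "c" shows "e \<in> before False k"
proof -
  have "(False, e) \<in> set EV" "(False, e) \<noteq> (c, e)" using assms event_edge set_EV by auto
  moreover have "(False, e) \<notin> set (drop (Suc k) EV)"
    using assms event_orders(2) dep_less_arr[OF event_edge] by (fastforce simp: event_order_def)
  ultimately show ?thesis using event_orders(5) unfolding before_def by blast
qed

text \<open>The mirror image for the backward sweep: at the arrival of \<open>e\<close>, the
  departures already passed are exactly the temporally possible continuations.\<close>

lemma departing_after_arrival: "c \<Longrightarrow> after False (Suc k) = {f \<in> E. arr e \<le> dep f}"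
proof (intro set_eqI iffI)
  fix f assume c: "c" and "f \<in> after False (Suc k)"
  then show "f \<in> {f \<in> E. arr e \<le> dep f}"
    using after_subset event_orders(2) by (fastforce simp: after_def event_order_def)
next
  fix f assume c: "c" and f: "f \<in> {f \<in> E. arr e \<le> dep f}"
  have "(False, f) \<in> set EV" "(False, f) \<noteq> (c, e)" using c f set_EV by auto
  moreover have "(False, f) \<notin> set (take k EV)"
    using f c event_orders(1) by (fastforce simp: event_order_def)
  ultimately show "f \<in> after False (Suc k)" using event_orders(5) unfolding after_def by blast
qed

lemma arriving_after_departure:
  assumes "\<not> c" shows "e \<in> after True (Suc k)"
proof -
  have "(True, e) \<in> set EV" "(True, e) \<noteq> (c, e)" using assms event_edge set_EV by auto
  moreover have "(True, e) \<notin> set (take k EV)"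
    using assms event_orders(1) dep_less_arr[OF event_edge] by (fastforce simp: event_order_def)
  ultimately show ?thesis using event_orders(5) unfolding after_def by blast
qed

end

section \<open>Merging the two lists\<close>

definition holds_event :: "store \<Rightarrow> nat \<Rightarrow> bool" where
  "holds_event \<sigma> k \<longleftrightarrow> natmem \<sigma> ''ev_kind'' k = of_bool (fst (EV ! k)) \<and>
     natmem \<sigma> ''ev_tail'' k = tail (snd (EV ! k)) \<and> natmem \<sigma> ''ev_head'' k = head (snd (EV ! k)) \<and>
     natmem \<sigma> ''ev_arr'' k = arr (snd (EV ! k)) \<and> natmem \<sigma> ''ev_code'' k = code (snd (EV ! k))"

definition input :: "store \<Rightarrow> bool" where
  "input \<sigma> \<longleftrightarrow> natmem \<sigma> ''M'' 0 = M \<and> natmem \<sigma> ''source'' 0 = s \<and>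
     holds_edges \<sigma> ''arr_tail'' ''arr_head'' ''arr_dep'' ''arr_trav'' Earr \<and>
     holds_edges \<sigma> ''dep_tail'' ''dep_head'' ''dep_dep'' ''dep_trav'' Edep"

definition loaded :: "store \<Rightarrow> bool" where
  "loaded \<sigma> \<longleftrightarrow> input \<sigma> \<and> (\<forall>k<2 * M. holds_event \<sigma> k)"

text \<open>Progress is expressed by the remaining suffixes, so one round of the loop is one
  unfolding of \<open>events\<close>.\<close>

definition merging :: "nat \<Rightarrow> store \<Rightarrow> bool" where
  "merging k \<sigma> \<longleftrightarrow> natmem \<sigma> ''i'' 0 \<le> M \<and> natmem \<sigma> ''j'' 0 \<le> M \<and>
     drop k EV = events (drop (natmem \<sigma> ''i'' 0) Edep) (drop (natmem \<sigma> ''j'' 0) Earr) \<and>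
     (\<forall>k'<k. holds_event \<sigma> k')"

lemma merging_step:
  assumes "input \<sigma>" and k: "k < 2 * M" "natmem \<tau> ''k'' 0 = k"
    and frame: "unwritten_eq (For ''k'' MM merge_body) \<sigma> \<tau>" and inv: "merging k \<tau>"
  shows "merging (Suc k) (nwrite ''k'' 0 (Suc k) (run merge_body \<tau>))"
proof -
  let ?i = "natmem \<tau> ''i'' 0" and ?j = "natmem \<tau> ''j'' 0"
  note fr = unwritten_eqD(1)[OF frame]
  have inp: "natmem \<tau> ''M'' 0 = M"
      "holds_edges \<tau> ''arr_tail'' ''arr_head'' ''arr_dep'' ''arr_trav'' Earr"
      "holds_edges \<tau> ''dep_tail'' ''dep_head'' ''dep_dep'' ''dep_trav'' Edep"
    using assms(1) unfolding input_def holds_edges_def by (simp_all add: fr body_defs)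
  have EVk: "drop k EV = EV ! k # drop (Suc k) EV" using k by (simp add: Cons_nth_drop_Suc)
  have di: "drop ?i Edep = Edep ! ?i # drop (Suc ?i) Edep" if "?i < M"
    using that by (simp add: Cons_nth_drop_Suc)
  have dj: "drop ?j Earr = Earr ! ?j # drop (Suc ?j) Earr" if "?j < M"
    using that by (simp add: Cons_nth_drop_Suc)
  have ev: "drop k EV = events (drop ?i Edep) (drop ?j Earr)" "?i \<le> M" "?j \<le> M"
    "\<forall>k'<k. holds_event \<tau> k'"
    using inv by (auto simp: merging_def)
  have arrj: "natmem \<tau> ''arr_dep'' ?j + natmem \<tau> ''arr_trav'' ?j = arr (Earr ! ?j)" if "?j < M"
    using inp(2) that by (simp add: holds_edges_def arr_def)
  have depi: "natmem \<tau> ''dep_dep'' ?i = dep (Edep ! ?i)" if "?i < M"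
    using inp(3) that by (simp add: holds_edges_def)
  have next_iff: "bval departure_next \<tau> \<longleftrightarrow> ?i < M \<and> (?j < M \<longrightarrow> dep (Edep ! ?i) < arr (Earr ! ?j))"
    using inp(1) arrj depi by (auto simp: departure_next_def)
  show ?thesis
  proof (cases "bval departure_next \<tau>")
    case True
    then have i: "?i < M" and j: "?j < M \<longrightarrow> dep (Edep ! ?i) < arr (Earr ! ?j)"
      using next_iff by auto
    have "drop k EV = (False, Edep ! ?i) # events (drop (Suc ?i) Edep) (drop ?j Earr)"
      using ev(1) di[OF i] dj j ev(3) by (cases "?j < M") auto
    then have e: "EV ! k = (False, Edep ! ?i)"
        "drop (Suc k) EV = events (drop (Suc ?i) Edep) (drop ?j Earr)"
      using EVk by auto
    \<comment> \<open>The code is computed after other writes of the same round, so its value is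
      needed in every store that agrees on the arrays read.\<close>
    have c: "nval (NCode ''dep_tail'' ''dep_head'' ''dep_dep'' ''dep_trav'' (Var ''i'')) \<tau>' = code (Edep ! ?i)"
      if "natmem \<tau>' ''i'' = natmem \<tau> ''i''" "natmem \<tau>' ''dep_tail'' = natmem \<tau> ''dep_tail''"
       "natmem \<tau>' ''dep_head'' = natmem \<tau> ''dep_head''" "natmem \<tau>' ''dep_dep'' = natmem \<tau> ''dep_dep''"
       "natmem \<tau>' ''dep_trav'' = natmem \<tau> ''dep_trav''" for \<tau>'
      using that i inp(3) by (subst nval_NCode[where es = Edep]) (auto simp: holds_edges_def)
    show ?thesis
      using True i ev inp(3) k e
      by (auto simp: merging_def merge_body_def store_event_def holds_event_def c holds_edges_def
            arr_def less_Suc_eq)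
  next
    case False
    \<comment> \<open>If arrivals were exhausted, the refusal of a departure would mean that
      departures are too, and no event would be left although \<open>k < 2 * M\<close>.\<close>
    have j: "?j < M"
    proof (rule ccontr)
      assume "\<not> ?j < M"
      moreover from this have "\<not> ?i < M" using False next_iff by auto
      ultimately show False using ev EVk by simp
    qed
    have "drop k EV = (True, Earr ! ?j) # events (drop ?i Edep) (drop (Suc ?j) Earr)"
      using ev(1) di dj[OF j] j False next_iff ev(2) by (cases "?i < M") auto
    then have e: "EV ! k = (True, Earr ! ?j)"
        "drop (Suc k) EV = events (drop ?i Edep) (drop (Suc ?j) Earr)"
      using EVk by auto
    have c: "nval (NCode ''arr_tail'' ''arr_head'' ''arr_dep'' ''arr_trav'' (Var ''j'')) \<tau>' = code (Earr ! ?j)"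
      if "natmem \<tau>' ''j'' = natmem \<tau> ''j''" "natmem \<tau>' ''arr_tail'' = natmem \<tau> ''arr_tail''"
       "natmem \<tau>' ''arr_head'' = natmem \<tau> ''arr_head''" "natmem \<tau>' ''arr_dep'' = natmem \<tau> ''arr_dep''"
       "natmem \<tau>' ''arr_trav'' = natmem \<tau> ''arr_trav''" for \<tau>'
      using that j inp(2) by (subst nval_NCode[where es = Earr]) (auto simp: holds_edges_def)
    show ?thesis
      using False j ev inp(2) k e
      by (auto simp: merging_def merge_body_def store_event_def holds_event_def c holds_edges_def
            arr_def less_Suc_eq)
  qed
qed

lemma runs_merge:
  assumes "input \<sigma>"
  shows "runs merge_prog ((6 + loop_rate MM merge_body) * Suc M) \<sigma> loaded"
proof -
  let ?c = "Seq (NWrite ''i'' (NConst 0) (NConst 0)) (NWrite ''j'' (NConst 0) (NConst 0))"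
  have "runs merge_prog (bound ?c + loop_rate MM merge_body * Suc M) \<sigma> loaded"
    unfolding merge_prog_def
  proof (rule runs_Seq[OF runs_run])
    fix \<sigma>' assume \<sigma>': "\<sigma>' = run ?c \<sigma>"
    have i: "input \<sigma>'" using assms unfolding \<sigma>' input_def holds_edges_def by simp
    have "runs (For ''k'' MM merge_body) (loop_rate MM merge_body * Suc M) \<sigma>' (merging (2 * M))"
    proof (rule runs_For_run[where m = "2 * M"])
      fix \<tau> assume "unwritten_eq (For ''k'' MM merge_body) \<sigma>' \<tau>"
      from unwritten_eqD(1)[OF this, of "''M''"] i show "nval MM \<tau> = 2 * M"
        by (simp add: body_defs MM_def input_def)
    next
      show "merging 0 (nwrite ''k'' 0 0 \<sigma>')" using \<sigma>' by (simp add: merging_def EV_def)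
    qed (use merging_step[OF i] in \<open>auto simp: body_defs\<close>)
    then show "runs (For ''k'' MM merge_body) (loop_rate MM merge_body * Suc M) \<sigma>' loaded"
    proof (rule runs_mono)
      fix \<tau> assume "unwritten_eq (For ''k'' MM merge_body) \<sigma>' \<tau>" "merging (2 * M) \<tau>"
      then show "loaded \<tau>"
        using i by (simp add: loaded_def merging_def input_def holds_edges_def unwritten_eq_def body_defs)
    qed simp
  qed simp
  then show ?thesis by (rule runs_mono) auto
qed


section \<open>Passes over the stored events\<close>

definition input_arrays :: "string set" where
  "input_arrays = {''M'', ''source'', ''arr_tail'', ''arr_head'', ''arr_dep'', ''arr_trav'',
     ''dep_tail'', ''dep_head'', ''dep_dep'', ''dep_trav''}"

definition event_arrays :: "string set" where
  "event_arrays = {''ev_kind'', ''ev_tail'', ''ev_head'', ''ev_arr'', ''ev_code''}"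

lemma loaded_cong:
  assumes "\<And>x. x \<in> input_arrays \<union> event_arrays \<Longrightarrow> natmem \<tau> x = natmem \<sigma> x"
  shows "loaded \<tau> \<longleftrightarrow> loaded \<sigma>"
  using assms
  by (simp add: loaded_def input_def holds_edges_def holds_event_def input_arrays_def event_arrays_def)

lemma loaded_write [simp]:
  "x \<notin> input_arrays \<union> event_arrays \<Longrightarrow> loaded (nwrite x i a \<tau>) \<longleftrightarrow> loaded \<tau>"
  "loaded (qwrite y i q \<tau>) \<longleftrightarrow> loaded \<tau>"
  by (rule loaded_cong; auto)+

lemma loadedD:
  assumes "loaded \<sigma>"
  shows "natmem \<sigma> ''M'' 0 = M" "natmem \<sigma> ''source'' 0 = s"
    and "k < 2 * M \<Longrightarrow> EV ! k = (b, e) \<Longrightarrow> natmem \<sigma> ''ev_kind'' k = of_bool b"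
    and "k < 2 * M \<Longrightarrow> EV ! k = (b, e) \<Longrightarrow> natmem \<sigma> ''ev_tail'' k = tail e"
    and "k < 2 * M \<Longrightarrow> EV ! k = (b, e) \<Longrightarrow> natmem \<sigma> ''ev_head'' k = head e"
    and "k < 2 * M \<Longrightarrow> EV ! k = (b, e) \<Longrightarrow> natmem \<sigma> ''ev_arr'' k = arr e"
    and "k < 2 * M \<Longrightarrow> EV ! k = (b, e) \<Longrightarrow> natmem \<sigma> ''ev_code'' k = code e"
  using assms by (auto simp: loaded_def input_def holds_event_def)

lemma runs_event_loop:
  assumes "loaded \<sigma>" "loop_free c" "(input_arrays \<union> event_arrays \<union> {''k''}) \<inter> nwrites c = {}"
    and "I 0 (nwrite ''k'' 0 0 \<sigma>)"
    and step: "\<And>k \<tau> b e. k < 2 * M \<Longrightarrow> EV ! k = (b, e) \<Longrightarrow> e \<in> E \<Longrightarrow> natmem \<tau> ''k'' 0 = k \<Longrightarrow>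
      loaded \<tau> \<Longrightarrow> unwritten_eq (For ''k'' MM c) \<sigma> \<tau> \<Longrightarrow> I k \<tau> \<Longrightarrow>
      I (Suc k) (nwrite ''k'' 0 (Suc k) (run c \<tau>))"
  shows "runs (For ''k'' MM c) (loop_rate MM c * Suc M) \<sigma> (\<lambda>\<tau>. loaded \<tau> \<and> I (2 * M) \<tau>)"
proof -
  have load: "loaded \<tau>" if "unwritten_eq (For ''k'' MM c) \<sigma> \<tau>" for \<tau>
  proof -
    have "natmem \<tau> x = natmem \<sigma> x" if "x \<in> input_arrays \<union> event_arrays" for x
    proof (rule unwritten_eqD(1)[OF \<open>unwritten_eq (For ''k'' MM c) \<sigma> \<tau>\<close>])
      have "''k'' \<notin> input_arrays \<union> event_arrays" by (simp add: input_arrays_def event_arrays_def)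
      then show "x \<notin> nwrites (For ''k'' MM c)" using assms(3) that by auto
    qed
    then show ?thesis using loaded_cong assms(1) by blast
  qed
  have "runs (For ''k'' MM c) (loop_rate MM c * Suc M) \<sigma> (I (2 * M))"
  proof (rule runs_For_run[where m = "2 * M"])
    fix \<tau> assume "unwritten_eq (For ''k'' MM c) \<sigma> \<tau>"
    from loadedD(1)[OF load[OF this]] show "nval MM \<tau> = 2 * M" by (simp add: MM_def)
  next
    fix k \<tau>
    assume k: "k < 2 * M" "natmem \<tau> ''k'' 0 = k" "unwritten_eq (For ''k'' MM c) \<sigma> \<tau>" "I k \<tau>"
    obtain b e where e: "EV ! k = (b, e)" by (meson surj_pair)
    show "I (Suc k) (nwrite ''k'' 0 (Suc k) (run c \<tau>))"
      by (rule step[OF k(1) e event_edge[OF k(1) e] k(2) load[OF k(3)] k(3,4)])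
  qed (use assms in auto)
  then show ?thesis by (rule runs_mono) (auto intro: load)
qed

section \<open>The forward sweep\<close>

definition node_dist :: "nat \<Rightarrow> nat \<Rightarrow> nat" where
  "node_dist k v = (if v = s then 0 else Min (insert (M + 1) (dist ` {e \<in> before True k. head e = v})))"

text \<open>The values 0 and 1 at \<open>s\<close> represent the empty walk. At a node without
  reachable arrivals the minimum is \<open>M + 1\<close>, which no edge has as distance, so the sum
  is 0.\<close>

definition node_count :: "nat \<Rightarrow> nat \<Rightarrow> nat" where
  "node_count k v = (if v = s then 1 else
     \<Sum>e | e \<in> before True k \<and> head e = v \<and> dist e = node_dist k v. count e)"

lemma departure_dist:
  assumes "k < 2 * M" "EV ! k = (False, f)"
  shows "dist f = Suc (node_dist k (tail f))" "count f = node_count k (tail f)"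
proof -
  have f: "f \<in> E" by (rule event_edge[OF assms])
  have b: "before True k = {e \<in> E. arr e \<le> dep f}"
    by (rule arrived_before_departure[OF assms]) simp
  then have l: "{e \<in> before True k. head e = tail f} = {e \<in> E. link e f}"
    by (auto simp: link_def)
  show d: "dist f = Suc (node_dist k (tail f))"
    using dist_source[OF f] dist_step[OF f] by (simp add: node_dist_def l)
  have "{e. e \<in> before True k \<and> head e = tail f \<and> dist e = node_dist k (tail f)} = {e \<in> E. pre e f}"
    using l d by (auto simp: pre_def)
  then show "count f = node_count k (tail f)"
    using count_source[OF f] count_step[OF f] by (simp add: node_count_def)
qed

lemma arrival_other:
  assumes "k < 2 * M" "EV ! k = (b, e)" "\<not> b \<or> v \<noteq> head e \<or> v = s"
  shows "node_dist (Suc k) v = node_dist k v" "node_count (Suc k) v = node_count k v"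
proof -
  have eq: "v \<noteq> s \<Longrightarrow> {e \<in> before True (Suc k). head e = v \<and> P e} = {e \<in> before True k. head e = v \<and> P e}" for P
    using assms(3) unfolding before_Suc[OF assms(1,2)] by auto
  from eq[of "\<lambda>_. True"] show d: "node_dist (Suc k) v = node_dist k v" by (simp add: node_dist_def)
  from eq show "node_count (Suc k) v = node_count k v" by (simp add: node_count_def d)
qed

lemma arrival_head:
  assumes "k < 2 * M" "EV ! k = (True, e)" "head e \<noteq> s"
  shows "node_dist (Suc k) (head e) = min (dist e) (node_dist k (head e))"
    and "node_count (Suc k) (head e) =
      (if dist e < node_dist k (head e) then 0 else node_count k (head e)) +
      (if dist e \<le> node_dist k (head e) then count e else 0)"
proof -
  let ?v = "head e"
  let ?A = "{f \<in> before True k. head f = ?v}"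
  have A': "{f \<in> before True (Suc k). head f = ?v} = insert e ?A"
    using before_Suc[OF assms(1,2), of True] by auto
  have fin: "finite ?A" by simp
  have "insert (M + 1) (dist ` insert e ?A) = insert (dist e) (insert (M + 1) (dist ` ?A))" by auto
  then have "Min (insert (M + 1) (dist ` insert e ?A)) = min (dist e) (Min (insert (M + 1) (dist ` ?A)))"
    using fin by (simp only:) (rule Min_insert; simp)
  then show d: "node_dist (Suc k) ?v = min (dist e) (node_dist k ?v)"
    using assms(3) by (simp only: node_dist_def A' if_False)
  have ge: "node_dist k ?v \<le> dist f" if "f \<in> ?A" for f
  proof -
    have "Min (insert (M + 1) (dist ` ?A)) \<le> dist f" using that fin by (intro Min_le) auto
    then show ?thesis using assms(3) by (simp only: node_dist_def if_False)
  qed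
  have e: "e \<notin> ?A" using event_not_before[OF assms(1,2)] by simp
  let ?S = "\<lambda>k. {f. f \<in> before True k \<and> head f = ?v \<and> dist f = node_dist k ?v}"
  have c: "node_count k ?v = sum count (?S k)" "node_count (Suc k) ?v = sum count (?S (Suc k))"
    using assms(3) by (simp_all add: node_count_def)
  have S: "?S (Suc k) = {f \<in> insert e ?A. dist f = min (dist e) (node_dist k ?v)}"
    using A' by (auto simp: d)
  consider "dist e < node_dist k ?v" | "dist e = node_dist k ?v" | "node_dist k ?v < dist e"
    by linarith
  then show "node_count (Suc k) ?v =
      (if dist e < node_dist k ?v then 0 else node_count k ?v) +
      (if dist e \<le> node_dist k ?v then count e else 0)"
  proof cases
    case 1
    \<comment> \<open>By \<open>ge\<close> every earlier arrival at this node is at least at the old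
      minimum, so none of them ties with the new one.\<close>
    then have "?S (Suc k) = {e}" unfolding S using ge by fastforce
    then show ?thesis using 1 c by simp
  next
    case 2
    then have "?S (Suc k) = insert e (?S k)" unfolding S by auto
    moreover have "e \<notin> ?S k" using e by auto
    ultimately show ?thesis using 2 c by simp
  next
    case 3
    then have "?S (Suc k) = ?S k" unfolding S by auto
    then show ?thesis using 3 c by simp
  qed
qed

definition initialising :: "nat \<Rightarrow> store \<Rightarrow> bool" where
  "initialising k \<sigma> \<longleftrightarrow> (\<forall>b. \<forall>e\<in>before b k. \<forall>v\<in>{tail e, head e}.
     natmem \<sigma> ''D'' v = M + 1 \<and> natmem \<sigma> ''C'' v = 0)"

definition forwarding :: "nat \<Rightarrow> store \<Rightarrow> bool" where
  "forwarding k \<sigma> \<longleftrightarrow>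
     (\<forall>f\<in>before False k. natmem \<sigma> ''dist'' (code f) = dist f \<and> natmem \<sigma> ''count'' (code f) = count f) \<and>
     (\<forall>e\<in>E. \<forall>v\<in>{tail e, head e}.
        natmem \<sigma> ''D'' v = node_dist k v \<and> natmem \<sigma> ''C'' v = node_count k v)"

definition distances :: "store \<Rightarrow> bool" where
  "distances \<sigma> \<longleftrightarrow>
     (\<forall>f\<in>E. natmem \<sigma> ''dist'' (code f) = dist f \<and> natmem \<sigma> ''count'' (code f) = count f)"

lemma forwarding_step:
  assumes k: "k < 2 * M" and ev: "EV ! k = (b, e)" and e: "e \<in> E" and kk: "natmem \<tau> ''k'' 0 = k"
    and load: "loaded \<tau>" and inv: "forwarding k \<tau>"
  shows "forwarding (Suc k) (nwrite ''k'' 0 (Suc k) (run forward_body \<tau>))"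
proof -
  note [simp] = kk loadedD(1,2)[OF load] loadedD(3-)[OF load k ev]
  have D: "natmem \<tau> ''D'' v = node_dist k v" "natmem \<tau> ''C'' v = node_count k v"
    if "f \<in> E" "v \<in> {tail f, head f}" for f v
    using inv that by (auto simp: forwarding_def)
  have old: "natmem \<tau> ''dist'' (code f) = dist f" "natmem \<tau> ''count'' (code f) = count f"
    if "f \<in> before False k" for f
    using inv that by (auto simp: forwarding_def)
  let ?\<tau> = "run forward_body \<tau>"
  show ?thesis
  proof (cases b)
    case False
    then have ev': "EV ! k = (False, e)" using ev by simp
    have "natmem ?\<tau> ''dist'' = (natmem \<tau> ''dist'')(code e := dist e)"
         "natmem ?\<tau> ''count'' = (natmem \<tau> ''count'')(code e := count e)"
         "natmem ?\<tau> ''D'' = natmem \<tau> ''D''" "natmem ?\<tau> ''C'' = natmem \<tau> ''C''"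
      using False D[OF e, of "tail e"] departure_dist[OF k ev'] by (simp_all add: forward_body_def)
    then show ?thesis
      using D old False arrival_other[OF k ev] before_Suc[OF k ev, of False]
      by (simp add: forwarding_def)
  next
    case True
    then have ev': "EV ! k = (True, e)" using ev by simp
    have de: "natmem \<tau> ''dist'' (code e) = dist e" "natmem \<tau> ''count'' (code e) = count e"
      using old departed_before_arrival[OF k ev'] by simp_all
    have Dh: "natmem \<tau> ''D'' (head e) = node_dist k (head e)" "natmem \<tau> ''C'' (head e) = node_count k (head e)"
      using D[OF e] by simp_all
    have new: "natmem ?\<tau> ''dist'' = natmem \<tau> ''dist''" "natmem ?\<tau> ''count'' = natmem \<tau> ''count''"
         "natmem ?\<tau> ''D'' = (natmem \<tau> ''D'')(head e := min (dist e) (node_dist k (head e)))"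
         "natmem ?\<tau> ''C'' = (natmem \<tau> ''C'')(head e :=
            (if dist e < node_dist k (head e) then 0 else node_count k (head e)) +
            (if dist e \<le> node_dist k (head e) then count e else 0))"
      using True de Dh by (auto simp: forward_body_def min_def fun_eq_iff)
    have "min (dist e) (node_dist k (head e)) = node_dist (Suc k) (head e) \<and>
      (if dist e < node_dist k (head e) then 0 else node_count k (head e)) +
            (if dist e \<le> node_dist k (head e) then count e else 0) = node_count (Suc k) (head e)"
    proof (cases "head e = s")
      case True
      \<comment> \<open>Distances of edges are positive, so the empty walk at the source is never
        beaten or tied.\<close>
      then have "node_dist k (head e) = 0" by (simp add: node_dist_def)
      then show ?thesis using arrival_other[OF k ev, of "head e"] True dist_pos[of e] by simp
    next
      case False
      then show ?thesis using arrival_head[OF k ev'] by simp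
    qed
    then have h: "natmem ?\<tau> ''D'' = (natmem \<tau> ''D'')(head e := node_dist (Suc k) (head e))"
         "natmem ?\<tau> ''C'' = (natmem \<tau> ''C'')(head e := node_count (Suc k) (head e))"
      using new by simp_all
    have "natmem ?\<tau> ''D'' v = node_dist (Suc k) v \<and> natmem ?\<tau> ''C'' v = node_count (Suc k) v"
      if "f \<in> E" "v \<in> {tail f, head f}" for f v
      using D[OF that] arrival_other[OF k ev, of v] by (simp add: h)
    moreover have "before False (Suc k) = before False k"
      using before_Suc[OF k ev'] by simp
    ultimately show ?thesis
      using old by (simp add: forwarding_def new(1,2))
  qed
qed

lemma runs_forward:
  assumes "loaded \<sigma>"
  shows "runs forward_prog ((loop_rate MM init_body + bound init_source + loop_rate MM forward_body) * Suc M)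
    \<sigma> (\<lambda>\<tau>. loaded \<tau> \<and> distances \<tau>)"
proof -
  let ?r = "bound init_source + loop_rate MM forward_body * Suc M"
  have "runs (For ''k'' MM init_body) (loop_rate MM init_body * Suc M) \<sigma> (\<lambda>\<tau>. loaded \<tau> \<and> initialising (2 * M) \<tau>)"
  proof (rule runs_event_loop[OF assms])
    fix k \<tau> b e
    assume *: "k < 2 * M" "EV ! k = (b, e)" "natmem \<tau> ''k'' 0 = k" "loaded \<tau>" "initialising k \<tau>"
    then show "initialising (Suc k) (nwrite ''k'' 0 (Suc k) (run init_body \<tau>))"
      by (auto simp: initialising_def init_body_def before_Suc[OF *(1,2)] loadedD[OF *(4)]
          split: if_splits)
  qed (auto simp: body_defs input_arrays_def event_arrays_def initialising_def)
  then have "runs forward_prog (loop_rate MM init_body * Suc M + ?r) \<sigma> (\<lambda>\<tau>. loaded \<tau> \<and> distances \<tau>)"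
    unfolding forward_prog_def
  proof (rule runs_Seq)
    fix \<sigma>1 assume 1: "loaded \<sigma>1 \<and> initialising (2 * M) \<sigma>1"
    show "runs (Seq init_source (For ''k'' MM forward_body)) ?r \<sigma>1 (\<lambda>\<tau>. loaded \<tau> \<and> distances \<tau>)"
    proof (rule runs_Seq[OF runs_run])
      show "loop_free init_source" by (simp add: body_defs)
    next
      fix \<sigma>2 assume 2: "\<sigma>2 = run init_source \<sigma>1"
      have load: "loaded \<sigma>2" using 1 by (simp add: 2 init_source_def input_arrays_def event_arrays_def)
      have "forwarding 0 (nwrite ''k'' 0 0 \<sigma>2)"
        using 1 by (auto simp: forwarding_def 2 init_source_def loadedD[of \<sigma>1] node_dist_def node_count_def
            initialising_def before_all)
      then have "runs (For ''k'' MM forward_body) (loop_rate MM forward_body * Suc M) \<sigma>2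
          (\<lambda>\<tau>. loaded \<tau> \<and> forwarding (2 * M) \<tau>)"
        by (intro runs_event_loop load forwarding_step)
          (auto simp: body_defs input_arrays_def event_arrays_def)
      then show "runs (For ''k'' MM forward_body) (loop_rate MM forward_body * Suc M) \<sigma>2
          (\<lambda>\<tau>. loaded \<tau> \<and> distances \<tau>)"
        by (rule runs_mono) (auto simp: forwarding_def distances_def before_all)
    qed
  qed
  then show ?thesis by (rule runs_mono) (auto simp: algebra_simps)
qed


section \<open>Foremost keys, totals and the backward sweep\<close>

definition some_key :: "store \<Rightarrow> nat tedge \<Rightarrow> bool" where
  "some_key \<sigma> e \<longleftrightarrow> (\<exists>f. reach f \<and> head f = head e \<and> natmem \<sigma> ''key'' (head e) = key f)"

text \<open>The minimum as an attained lower bound: attainment is set up while clearing and kept by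
  every overwrite, and the bound is built up event by event.\<close>

definition keys_minimal :: "store \<Rightarrow> bool" where
  "keys_minimal \<sigma> \<longleftrightarrow> (\<forall>e. reach e \<longrightarrow> some_key \<sigma> e \<and> natmem \<sigma> ''key'' (head e) \<le> key e)"

text \<open>The two cells that the backward sweep touches on account of \<open>e\<close>: one is
  read at the arrival, the other updated at the departure.\<close>

definition zero_flow :: "store \<Rightarrow> nat tedge \<Rightarrow> bool" where
  "zero_flow \<sigma> e \<longleftrightarrow> ratmem \<sigma> ''flow'' (pair (head e) (Suc (dist e))) = 0 \<and>
     ratmem \<sigma> ''flow'' (pair (tail e) (dist e)) = 0"

definition clearing :: "nat \<Rightarrow> store \<Rightarrow> bool" where
  "clearing k \<sigma> \<longleftrightarrow> (\<forall>b. \<forall>e\<in>before b k. (reach e \<longrightarrow> some_key \<sigma> e) \<and>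
     natmem \<sigma> ''total'' (head e) = 0 \<and> zero_flow \<sigma> e)"

definition minimising :: "nat \<Rightarrow> store \<Rightarrow> bool" where
  "minimising k \<sigma> \<longleftrightarrow> (\<forall>e. reach e \<longrightarrow> some_key \<sigma> e) \<and>
     (\<forall>b. \<forall>e\<in>before b k. reach e \<longrightarrow> natmem \<sigma> ''key'' (head e) \<le> key e)"

definition totalling :: "nat \<Rightarrow> store \<Rightarrow> bool" where
  "totalling k \<sigma> \<longleftrightarrow> (\<forall>e\<in>E. natmem \<sigma> ''total'' (head e) =
     (\<Sum>f | f \<in> before True k \<and> final f \<and> head f = head e. count f))"

definition totals :: "store \<Rightarrow> bool" where
  "totals \<sigma> \<longleftrightarrow> (\<forall>e\<in>E. natmem \<sigma> ''total'' (head e) = total (head e))"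

definition flow :: "nat \<Rightarrow> nat \<Rightarrow> nat \<Rightarrow> rat" where
  "flow k v d = (\<Sum>f | f \<in> after False k \<and> tail f = v \<and> dist f = d. delta f)"

text \<open>Here \<open>nb\<close> is the content of the node array before the sweep, which carries
  the contributions of earlier sources.\<close>

definition backwarding :: "(nat \<Rightarrow> rat) \<Rightarrow> nat \<Rightarrow> store \<Rightarrow> bool" where
  "backwarding nb k \<sigma> \<longleftrightarrow>
     (\<forall>e\<in>after True k. ratmem \<sigma> ''delta'' (code e) = delta e) \<and>
     (\<forall>e\<in>E. ratmem \<sigma> ''flow'' (pair (head e) (Suc (dist e))) = flow k (head e) (Suc (dist e)) \<and>
        ratmem \<sigma> ''flow'' (pair (tail e) (dist e)) = flow k (tail e) (dist e)) \<and>
     (\<forall>u. ratmem \<sigma> ''node_betweenness'' u =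
        nb u + (\<Sum>e | e \<in> after True k \<and> head e = u. of_nat (count e) * succ_delta e))"

lemma distances_cong:
  assumes "\<And>x. x \<in> {''dist'', ''count''} \<Longrightarrow> natmem \<tau> x = natmem \<sigma> x"
  shows "distances \<tau> \<longleftrightarrow> distances \<sigma>"
  using assms by (simp add: distances_def)

lemma distances_write [simp]:
  "x \<notin> {''dist'', ''count''} \<Longrightarrow> distances (nwrite x i a \<tau>) \<longleftrightarrow> distances \<tau>"
  "distances (qwrite y i q \<tau>) \<longleftrightarrow> distances \<tau>"
  by (rule distances_cong; auto)+

lemma keys_minimal_cong:
  "natmem \<tau> ''key'' = natmem \<sigma> ''key'' \<Longrightarrow> keys_minimal \<tau> \<longleftrightarrow> keys_minimal \<sigma>"
  by (simp add: keys_minimal_def some_key_def)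

lemma keys_minimal_write [simp]:
  "x \<noteq> ''key'' \<Longrightarrow> keys_minimal (nwrite x i a \<tau>) \<longleftrightarrow> keys_minimal \<tau>"
  "keys_minimal (qwrite y i q \<tau>) \<longleftrightarrow> keys_minimal \<tau>"
  by (rule keys_minimal_cong; auto)+

lemma final_iff_key:
  assumes "keys_minimal \<sigma>"
  shows "final e \<longleftrightarrow> reach e \<and> head e \<noteq> s \<and> key e = natmem \<sigma> ''key'' (head e)"
proof
  assume f: "final e"
  then obtain g where "reach g" "head g = head e" "natmem \<sigma> ''key'' (head e) = key g"
    using assms final_reach unfolding keys_minimal_def some_key_def by metis
  then have "key e = natmem \<sigma> ''key'' (head e)"
    using f assms unfolding final_def keys_minimal_def by (metis le_antisym)
  then show "reach e \<and> head e \<noteq> s \<and> key e = natmem \<sigma> ''key'' (head e)"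
    using f by (simp add: final_def)
next
  assume "reach e \<and> head e \<noteq> s \<and> key e = natmem \<sigma> ''key'' (head e)"
  then show "final e" using assms unfolding final_def keys_minimal_def by metis
qed

context
  fixes \<tau> k b e a
  assumes load: "loaded \<tau>" and dists: "distances \<tau>" and k: "k < 2 * M" and ev: "EV ! k = (b, e)"
    and a: "nval a \<tau> = k"
begin

lemma nval_edist: "nval (edist a) \<tau> = dist e" and nval_ecount: "nval (ecount a) \<tau> = count e"
  using dists event_edge[OF k ev] a by (simp_all add: loadedD(3-)[OF load k ev] distances_def)

lemma nval_ekey: "nval (ekey a) \<tau> = key e"
  using nval_edist a by (simp add: ekey_def key_def loadedD(1)[OF load] loadedD(3-)[OF load k ev])

lemma bval_ereach: "bval (ereach a) \<tau> \<longleftrightarrow> reach e"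
  using nval_edist by (simp add: ereach_def reach_iff_dist loadedD(1)[OF load])

lemma bval_efinal: "keys_minimal \<tau> \<Longrightarrow> bval (efinal a) \<tau> \<longleftrightarrow> final e"
  using bval_ereach nval_ekey final_iff_key[of \<tau> e] a
  by (simp add: efinal_def loadedD(2)[OF load] loadedD(3-)[OF load k ev])

end

lemma clearing_step:
  assumes k: "k < 2 * M" and ev: "EV ! k = (b, e)" and kk: "natmem \<tau> ''k'' 0 = k"
    and load: "loaded \<tau>" and dists: "distances \<tau>" and inv: "clearing k \<tau>"
  shows "clearing (Suc k) (nwrite ''k'' 0 (Suc k) (run clear_body \<tau>))"
proof -
  have a: "nval (Var ''k'') \<tau> = k" using kk by simp
  let ?\<tau> = "run clear_body \<tau>"
  note [simp] = loadedD(3-)[OF load k ev] kk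
  have d: "natmem \<tau> ''dist'' (code e) = dist e"
    using nval_edist[OF load dists k ev a] by simp
  have new: "natmem ?\<tau> ''key'' = (if reach e then (natmem \<tau> ''key'')(head e := key e) else natmem \<tau> ''key'')"
    "natmem ?\<tau> ''total'' = (natmem \<tau> ''total'')(head e := 0)"
    "ratmem ?\<tau> ''flow'' = (ratmem \<tau> ''flow'')(pair (head e) (Suc (dist e)) := 0, pair (tail e) (dist e) := 0)"
    using bval_ereach[OF load dists k ev a] nval_ekey[OF load dists k ev a] d
    by (simp_all add: clear_body_def)
  have "(reach f \<longrightarrow> some_key ?\<tau> f) \<and> natmem ?\<tau> ''total'' (head f) = 0 \<and> zero_flow ?\<tau> f"
    if f: "f = e \<or> f \<in> before c k" for c f
  proof -
    have "some_key ?\<tau> f" if "reach f"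
    \<comment> \<open>The write for \<open>e\<close> may hit the cell belonging to \<open>f\<close>;
      the new value is then the key of \<open>e\<close>, which is again attained at that
      head.\<close>
    proof (cases "reach e \<and> head f = head e")
      case True
      then show ?thesis unfolding some_key_def new by auto
    next
      case False
      then have "f \<in> before c k" using f that by auto
      then have "some_key \<tau> f" using inv that by (auto simp: clearing_def)
      then show ?thesis using False unfolding some_key_def new by auto
    qed
    moreover have "natmem ?\<tau> ''total'' (head f) = 0 \<and> zero_flow ?\<tau> f"
    proof (cases "f = e")
      case True
      then show ?thesis by (simp add: new zero_flow_def)
    next
      case False
      then have "natmem \<tau> ''total'' (head f) = 0 \<and> zero_flow \<tau> f"
        using f inv by (simp add: clearing_def)
      \<comment> \<open>Cells of different edges may coincide, but writing 0 never destroys a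
        0.\<close>
      moreover have "ratmem ?\<tau> ''flow'' x = 0" if "ratmem \<tau> ''flow'' x = 0" for x
        using that by (simp add: new)
      ultimately show ?thesis by (simp add: new(2) zero_flow_def)
    qed
    ultimately show ?thesis by blast
  qed
  moreover have "f = e \<or> f \<in> before c k" if "f \<in> before c (Suc k)" for c f
    using that before_Suc[OF k ev] by (metis insertE)
  ultimately have "clearing (Suc k) ?\<tau>" unfolding clearing_def by blast
  then show ?thesis by (simp add: clearing_def some_key_def zero_flow_def)
qed

lemma minimising_step:
  assumes k: "k < 2 * M" and ev: "EV ! k = (b, e)" and kk: "natmem \<tau> ''k'' 0 = k"
    and load: "loaded \<tau>" and dists: "distances \<tau>" and inv: "minimising k \<tau>"
  shows "minimising (Suc k) (nwrite ''k'' 0 (Suc k) (run key_body \<tau>))"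
proof -
  have a: "nval (Var ''k'') \<tau> = k" using kk by simp
  let ?\<tau> = "run key_body \<tau>"
  note [simp] = loadedD(3-)[OF load k ev] kk
  have new: "natmem ?\<tau> ''key'' = (if reach e then (natmem \<tau> ''key'')(head e := min (key e) (natmem \<tau> ''key'' (head e)))
      else natmem \<tau> ''key'')"
    using bval_ereach[OF load dists k ev a] nval_ekey[OF load dists k ev a]
    by (auto simp add: key_body_def min_def)
  have some: "some_key ?\<tau> f" if "reach f" for f
  proof -
    have "some_key \<tau> f" using inv that by (auto simp: minimising_def)
    then show ?thesis unfolding some_key_def new by (auto simp: min_def)
  qed
  have le: "natmem ?\<tau> ''key'' (head f) \<le> key f" if "reach f" "f = e \<or> f \<in> before c k" for c f
  proof (cases "f = e")
    case True
    then show ?thesis using that by (simp add: new)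
  next
    case False
    then have "natmem \<tau> ''key'' (head f) \<le> key f" using inv that by (simp add: minimising_def)
    then show ?thesis by (auto simp: new min_def split: if_splits)
  qed
  have "f = e \<or> f \<in> before c k" if "f \<in> before c (Suc k)" for c f
    using that before_Suc[OF k ev] by (metis insertE)
  then have "\<forall>c. \<forall>f\<in>before c (Suc k). reach f \<longrightarrow> natmem ?\<tau> ''key'' (head f) \<le> key f"
    using le by blast
  then show ?thesis
    using some by (simp add: minimising_def some_key_def)
qed

lemma totalling_step:
  assumes k: "k < 2 * M" and ev: "EV ! k = (b, e)" and kk: "natmem \<tau> ''k'' 0 = k"
    and load: "loaded \<tau>" and dists: "distances \<tau>" and keys: "keys_minimal \<tau>" and inv: "totalling k \<tau>"
  shows "totalling (Suc k) (nwrite ''k'' 0 (Suc k) (run total_body \<tau>))"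
proof -
  have a: "nval (Var ''k'') \<tau> = k" using kk by simp
  let ?\<tau> = "run total_body \<tau>"
  let ?S = "\<lambda>k v. {f. f \<in> before True k \<and> final f \<and> head f = v}"
  note [simp] = loadedD(3-)[OF load k ev] kk
  have new: "natmem ?\<tau> ''total'' = (if b \<and> final e
      then (natmem \<tau> ''total'')(head e := natmem \<tau> ''total'' (head e) + count e) else natmem \<tau> ''total'')"
    using bval_efinal[OF load dists k ev a keys] nval_ecount[OF load dists k ev a]
    by (simp add: total_body_def)
  have S: "?S (Suc k) v = (if b \<and> final e \<and> head e = v then insert e (?S k v) else ?S k v)" for v
    using before_Suc[OF k ev] by auto
  have "sum count (?S (Suc k) v) = (if b \<and> final e \<and> head e = v then count e else 0) + sum count (?S k v)" for v
    unfolding S using event_not_before[OF k ev] by auto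
  then show ?thesis
    using inv by (auto simp: totalling_def new)
qed

text \<open>The index \<open>k\<close> is the position in the event list, and the loop counter is
  its mirror image. At a departure \<open>arriving_after_departure\<close> supplies the finished
  \<open>delta e\<close>; at an arrival \<open>departing_after_arrival\<close> shows that the
  \<open>flow\<close> cell holds the full sum over successors.\<close>

lemma backwarding_step:
  assumes k: "k < 2 * M" and ev: "EV ! k = (b, e)" and kk: "natmem \<tau> ''k'' 0 = 2 * M - Suc k"
    and load: "loaded \<tau>" and dists: "distances \<tau>" and keys: "keys_minimal \<tau>"
    and tot: "totals \<tau>" and inv: "backwarding nb (Suc k) \<tau>"
  shows "backwarding nb k (run backward_body \<tau>)"
proof -
  have e: "e \<in> E" by (rule event_edge[OF k ev])
  let ?\<tau> = "run backward_body \<tau>" and ?q = "nwrite ''q'' 0 k \<tau>"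
  have q: "nwrite ''q'' 0 (2 * M - Suc 0 - (2 * M - Suc k)) \<tau> = ?q"
    using k by simp
  have d: "natmem \<tau> ''dist'' (code e) = dist e" "natmem \<tau> ''count'' (code e) = count e"
    using dists e by (simp_all add: distances_def)
  have t: "natmem \<tau> ''total'' (head e) = total (head e)" using tot e by (simp add: totals_def)
  note [simp] = loadedD(1)[OF load] loadedD(3-)[OF load k ev] kk
  have fl: "ratmem \<tau> ''flow'' (pair (head f) (Suc (dist f))) = flow (Suc k) (head f) (Suc (dist f))"
      "ratmem \<tau> ''flow'' (pair (tail f) (dist f)) = flow (Suc k) (tail f) (dist f)" if "f \<in> E" for f
    using inv that by (auto simp: backwarding_def)
  have mm: "nval MM \<tau> = 2 * M" by (simp add: MM_def)
  show ?thesis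
  proof (cases b)
    case False
    then have ev': "EV ! k = (False, e)" using ev by simp
    have de: "ratmem \<tau> ''delta'' (code e) = delta e"
      using inv arriving_after_departure[OF k ev'] by (auto simp: backwarding_def)
    have new: "ratmem ?\<tau> ''flow'' = (ratmem \<tau> ''flow'')(pair (tail e) (dist e) := flow (Suc k) (tail e) (dist e) + delta e)"
      "ratmem ?\<tau> ''delta'' = ratmem \<tau> ''delta''" "ratmem ?\<tau> ''node_betweenness'' = ratmem \<tau> ''node_betweenness''"
      using False d de fl(2)[OF e] q by (simp_all add: backward_body_def mm)
    have step: "flow k v c = flow (Suc k) v c + (if v = tail e \<and> c = dist e then delta e else 0)" for v c
    proof -
      have "{f. f \<in> after False k \<and> tail f = v \<and> dist f = c} =
         (if v = tail e \<and> c = dist e then insert e {f. f \<in> after False (Suc k) \<and> tail f = v \<and> dist f = c}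
          else {f. f \<in> after False (Suc k) \<and> tail f = v \<and> dist f = c})"
        using after_step[OF k ev'] by auto
      then show ?thesis unfolding flow_def using event_not_after[OF k ev'] by auto
    qed
    have "ratmem ?\<tau> ''flow'' (pair v c) = flow k v c"
      if "ratmem \<tau> ''flow'' (pair v c) = flow (Suc k) v c" for v c
      using that by (auto simp: new step)
    moreover have "after True k = after True (Suc k)" using after_step[OF k ev'] by simp
    ultimately show ?thesis
      using inv fl by (simp add: backwarding_def new(2,3))
  next
    case True
    then have ev': "EV ! k = (True, e)" using ev by simp
    have "flow (Suc k) (head e) (Suc (dist e)) = succ_delta e"
    proof -
      have "after False (Suc k) = {f \<in> E. arr e \<le> dep f}"
        by (rule departing_after_arrival[OF k ev']) simp
      then have "{f. f \<in> after False (Suc k) \<and> tail f = head e \<and> dist f = Suc (dist e)} = {f. f \<in> E \<and> pre e f}"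
        by (auto simp: pre_def link_def)
      then show ?thesis by (simp only: flow_def succ_delta_def)
    qed
    then have f: "ratmem \<tau> ''flow'' (pair (head e) (Suc (dist e))) = succ_delta e" using fl(1)[OF e] by simp
    \<comment> \<open>Finality is tested after two writes to rational arrays; it reads natural
      numbers only.\<close>
    have fin: "bval (efinal (Var ''q'')) (qwrite y i x (qwrite y' i' x' ?q)) \<longleftrightarrow> final e" for y i x y' i' x'
      by (rule bval_efinal[OF _ _ k ev])
        (use load dists keys in \<open>simp_all add: input_arrays_def event_arrays_def\<close>)
    have new: "ratmem ?\<tau> ''flow'' = ratmem \<tau> ''flow''"
      "ratmem ?\<tau> ''delta'' = (ratmem \<tau> ''delta'')(code e := delta e)"
      "ratmem ?\<tau> ''node_betweenness'' = (ratmem \<tau> ''node_betweenness'')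
         (head e := ratmem \<tau> ''node_betweenness'' (head e) + of_nat (count e) * succ_delta e)"
      using True d f q t by (simp_all add: backward_body_def mm fin delta_step[of e])
    have "(\<Sum>f | f \<in> after True k \<and> head f = u. of_nat (count f) * succ_delta f) =
        (\<Sum>f | f \<in> after True (Suc k) \<and> head f = u. of_nat (count f) * succ_delta f) +
        (if u = head e then of_nat (count e) * succ_delta e else 0)" for u
    proof -
      have "{f. f \<in> after True k \<and> head f = u} =
        (if u = head e then insert e {f. f \<in> after True (Suc k) \<and> head f = u}
         else {f. f \<in> after True (Suc k) \<and> head f = u})"
        using after_step[OF k ev'] by auto
      then show ?thesis using event_not_after[OF k ev'] by auto
    qed
    moreover have "flow k = flow (Suc k)"
      using after_step[OF k ev'] by (simp add: flow_def fun_eq_iff)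
    ultimately show ?thesis
      using inv after_step[OF k ev'] by (auto simp: backwarding_def new)
  qed
qed


section \<open>Correctness and cost of the passes for one source\<close>

lemma runs_weight:
  assumes "loaded \<sigma>" "distances \<sigma>"
  shows "runs weight_prog ((loop_rate MM clear_body + loop_rate MM key_body + loop_rate MM total_body) * Suc M)
    \<sigma> (\<lambda>\<tau>. loaded \<tau> \<and> distances \<tau> \<and> keys_minimal \<tau> \<and> totals \<tau> \<and> (\<forall>e\<in>E. zero_flow \<tau> e))"
    (is "runs _ _ _ ?Q")
proof -
  let ?r = "\<lambda>c. loop_rate MM c * Suc M"
  have body: "loop_free c" "(input_arrays \<union> event_arrays \<union> {''k''}) \<inter> nwrites c = {}"
    "''dist'' \<notin> nwrites c" "''count'' \<notin> nwrites c" if "c \<in> {clear_body, key_body, total_body}" for c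
    using that by (auto simp: body_defs input_arrays_def event_arrays_def)
  have keep: "distances \<tau>" if "unwritten_eq (For ''k'' MM c) \<sigma>' \<tau>" "distances \<sigma>'"
      "c \<in> {clear_body, key_body, total_body}" for c \<sigma>' \<tau>
  proof -
    have "natmem \<tau> ''dist'' = natmem \<sigma>' ''dist''" "natmem \<tau> ''count'' = natmem \<sigma>' ''count''"
      using unwritten_eqD(1)[OF that(1)] body(3,4)[OF that(3)] by simp_all
    then show ?thesis using that(2) by (simp add: distances_def)
  qed
  have "runs (For ''k'' MM clear_body) (?r clear_body) \<sigma> (\<lambda>\<tau>. loaded \<tau> \<and> clearing (2 * M) \<tau>)"
  proof (rule runs_event_loop[OF assms(1) body(1,2)])
    show "clearing 0 (nwrite ''k'' 0 0 \<sigma>)" by (simp add: clearing_def)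
  next
    fix k \<tau> b e
    assume "k < 2 * M" "EV ! k = (b, e)" "natmem \<tau> ''k'' 0 = k" "loaded \<tau>"
      "unwritten_eq (For ''k'' MM clear_body) \<sigma> \<tau>" "clearing k \<tau>"
    then show "clearing (Suc k) (nwrite ''k'' 0 (Suc k) (run clear_body \<tau>))"
      using keep[OF _ assms(2)] by (intro clearing_step) auto
  qed simp_all
  then have "runs weight_prog (?r clear_body + (?r key_body + ?r total_body)) \<sigma> ?Q"
    unfolding weight_prog_def
  proof (rule runs_Seq)
    fix \<sigma>1 assume u1: "unwritten_eq (For ''k'' MM clear_body) \<sigma> \<sigma>1" and c1: "loaded \<sigma>1 \<and> clearing (2 * M) \<sigma>1"
    have d1: "distances \<sigma>1" using keep[OF u1 assms(2)] by simp
    have "\<forall>e. reach e \<longrightarrow> some_key \<sigma>1 e" and t1: "\<forall>e\<in>E. natmem \<sigma>1 ''total'' (head e) = 0"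
      and z1: "\<forall>e\<in>E. zero_flow \<sigma>1 e"
      using c1 reach_in_E by (auto simp: clearing_def before_all)
    then have m1: "minimising 0 (nwrite ''k'' 0 0 \<sigma>1)" by (simp add: minimising_def some_key_def)
    have "runs (For ''k'' MM key_body) (?r key_body) \<sigma>1 (\<lambda>\<tau>. loaded \<tau> \<and> minimising (2 * M) \<tau>)"
    proof (rule runs_event_loop[where I = minimising and c = key_body, OF _ body(1,2) m1])
      fix k \<tau> b e
      assume "k < 2 * M" "EV ! k = (b, e)" "natmem \<tau> ''k'' 0 = k" "loaded \<tau>"
        "unwritten_eq (For ''k'' MM key_body) \<sigma>1 \<tau>" "minimising k \<tau>"
      then show "minimising (Suc k) (nwrite ''k'' 0 (Suc k) (run key_body \<tau>))"
        using keep[OF _ d1] by (intro minimising_step) auto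
    qed (use c1 in simp_all)
    then show "runs (Seq (For ''k'' MM key_body) (For ''k'' MM total_body)) (?r key_body + ?r total_body) \<sigma>1 ?Q"
    proof (rule runs_Seq)
      fix \<sigma>2 assume u2: "unwritten_eq (For ''k'' MM key_body) \<sigma>1 \<sigma>2" and c2: "loaded \<sigma>2 \<and> minimising (2 * M) \<sigma>2"
      have d2: "distances \<sigma>2" using keep[OF u2 d1] by simp
      have k2: "keys_minimal \<sigma>2" using c2 reach_in_E
        unfolding keys_minimal_def minimising_def before_all by blast
      have "natmem \<sigma>2 ''total'' = natmem \<sigma>1 ''total''" "ratmem \<sigma>2 ''flow'' = ratmem \<sigma>1 ''flow''"
        using unwritten_eqD[OF u2] by (simp_all add: body_defs)
      then have t2: "totalling 0 (nwrite ''k'' 0 0 \<sigma>2)" and z2: "\<forall>e\<in>E. zero_flow \<sigma>2 e"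
        using t1 z1 by (simp_all add: totalling_def zero_flow_def)
      have keep2: "keys_minimal \<tau> \<and> distances \<tau> \<and> (\<forall>e\<in>E. zero_flow \<tau> e)"
        if "unwritten_eq (For ''k'' MM total_body) \<sigma>2 \<tau>" for \<tau>
      proof -
        have "natmem \<tau> ''key'' = natmem \<sigma>2 ''key''" "ratmem \<tau> ''flow'' = ratmem \<sigma>2 ''flow''"
          using unwritten_eqD[OF that] by (simp_all add: body_defs)
        then show ?thesis
          using keep[OF that d2] keys_minimal_cong[of \<tau> \<sigma>2] k2 z2 by (simp add: zero_flow_def)
      qed
      have "runs (For ''k'' MM total_body) (?r total_body) \<sigma>2 (\<lambda>\<tau>. loaded \<tau> \<and> totalling (2 * M) \<tau>)"
      proof (rule runs_event_loop[where I = totalling and c = total_body, OF _ body(1,2) t2])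
        fix k \<tau> b e
        assume "k < 2 * M" "EV ! k = (b, e)" "natmem \<tau> ''k'' 0 = k" "loaded \<tau>"
          "unwritten_eq (For ''k'' MM total_body) \<sigma>2 \<tau>" "totalling k \<tau>"
        then show "totalling (Suc k) (nwrite ''k'' 0 (Suc k) (run total_body \<tau>))"
          using keep2 by (intro totalling_step) auto
      qed (use c2 in simp_all)
      then show "runs (For ''k'' MM total_body) (?r total_body) \<sigma>2 ?Q"
      proof (rule runs_mono)
        fix \<tau> assume u: "unwritten_eq (For ''k'' MM total_body) \<sigma>2 \<tau>" and c: "loaded \<tau> \<and> totalling (2 * M) \<tau>"
        have "{f. f \<in> E \<and> final f \<and> head f = v} = {f. final f \<and> head f = v}" for v
          using final_reach reach_in_E by blast
        then have "totals \<tau>" using c by (simp add: totalling_def totals_def total_def before_all)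
        then show "?Q \<tau>" using c keep2[OF u] by blast
      qed simp
    qed
  qed
  then show ?thesis by (rule runs_mono) (auto simp: algebra_simps)
qed

lemma runs_finish:
  assumes "loaded \<sigma>" "distances \<sigma>" "keys_minimal \<sigma>" "totals \<sigma>" "\<forall>e\<in>E. zero_flow \<sigma> e"
  shows "runs finish_prog ((loop_rate MM backward_body + loop_rate (Var ''M'') output_body) * Suc M) \<sigma>
    (\<lambda>\<tau>. (\<forall>i<M. ratmem \<tau> ''edge_betweenness'' i = edge_betweenness G s (Earr ! i)) \<and>
       (\<forall>u. ratmem \<tau> ''node_betweenness'' u = ratmem \<sigma> ''node_betweenness'' u +
          (\<Sum>e\<in>in_edges G u. of_nat (count e) * succ_delta e)))" (is "runs _ _ _ ?Q")
proof -
  let ?nb = "ratmem \<sigma> ''node_betweenness''"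
  let ?I = "\<lambda>k \<tau>. backwarding ?nb (2 * M - k) \<tau>"
  have keep: "distances \<tau> \<and> keys_minimal \<tau> \<and> totals \<tau>"
    if "unwritten_eq (For ''k'' MM backward_body) \<sigma> \<tau>" for \<tau>
  proof -
    have "natmem \<tau> ''key'' = natmem \<sigma> ''key''" "natmem \<tau> ''dist'' = natmem \<sigma> ''dist''"
      "natmem \<tau> ''count'' = natmem \<sigma> ''count''" "natmem \<tau> ''total'' = natmem \<sigma> ''total''"
      using unwritten_eqD[OF that] by (simp_all add: body_defs)
    then show ?thesis
      using keys_minimal_cong[of \<tau> \<sigma>] assms by (simp add: distances_def totals_def)
  qed
  have "runs (For ''k'' MM backward_body) (loop_rate MM backward_body * Suc M) \<sigma>
      (\<lambda>\<tau>. loaded \<tau> \<and> ?I (2 * M) \<tau>)"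
  proof (rule runs_event_loop[where I = ?I and c = backward_body, OF assms(1)])
    show "?I 0 (nwrite ''k'' 0 0 \<sigma>)"
      using assms(5) by (simp add: backwarding_def flow_def zero_flow_def)
  next
    fix k \<tau> b e
    assume k: "k < 2 * M" and kk: "natmem \<tau> ''k'' 0 = k" and load: "loaded \<tau>"
      and u: "unwritten_eq (For ''k'' MM backward_body) \<sigma> \<tau>" and inv: "?I k \<tau>"
    let ?q = "2 * M - Suc k"
    \<comment> \<open>The event to process sits at the mirrored position, not at position
      \<open>k\<close> as in the other passes.\<close>
    obtain b' e' where ev: "EV ! ?q = (b', e')" by (meson surj_pair)
    have q: "Suc ?q = 2 * M - k" "?q < 2 * M" "k = 2 * M - Suc ?q" using k by simp_all
    have "backwarding ?nb ?q (run backward_body \<tau>)"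
      by (rule backwarding_step[OF q(2) ev])
        (use keep[OF u] load inv kk q in \<open>simp_all del: Suc_diff_Suc\<close>)
    then show "?I (Suc k) (nwrite ''k'' 0 (Suc k) (run backward_body \<tau>))"
      by (simp add: backwarding_def)
  qed (auto simp: body_defs input_arrays_def event_arrays_def MM_def)
  then have "runs finish_prog (loop_rate MM backward_body * Suc M + loop_rate (Var ''M'') output_body * Suc M) \<sigma> ?Q"
    unfolding finish_prog_def
  proof (rule runs_Seq)
    fix \<sigma>1 assume u1: "unwritten_eq (For ''k'' MM backward_body) \<sigma> \<sigma>1" and c1: "loaded \<sigma>1 \<and> ?I (2 * M) \<sigma>1"
    have inp: "natmem \<sigma>1 ''M'' 0 = M" "holds_edges \<sigma>1 ''arr_tail'' ''arr_head'' ''arr_dep'' ''arr_trav'' Earr"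
      using c1 by (auto simp: loaded_def input_def)
    have d1: "ratmem \<sigma>1 ''delta'' (code e) = delta e" "natmem \<sigma>1 ''count'' (code e) = count e" if "e \<in> E" for e
      using that c1 keep[OF u1] by (auto simp: backwarding_def distances_def after_0)
    have "runs (For ''k'' (Var ''M'') output_body) (loop_rate (Var ''M'') output_body * Suc M) \<sigma>1
      (\<lambda>\<tau>. \<forall>i<M. ratmem \<tau> ''edge_betweenness'' i = edge_betweenness G s (Earr ! i))"
    proof (rule runs_For_run[where m = M and I = "\<lambda>k \<tau>. \<forall>i<k. ratmem \<tau> ''edge_betweenness'' i = edge_betweenness G s (Earr ! i)"])
      fix \<tau> assume "unwritten_eq (For ''k'' (Var ''M'') output_body) \<sigma>1 \<tau>"
      from unwritten_eqD(1)[OF this, of "''M''"] show "nval (Var ''M'') \<tau> = M"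
        using inp by (simp add: body_defs)
    next
      fix k \<tau>
      assume k: "k < M" "natmem \<tau> ''k'' 0 = k" and u: "unwritten_eq (For ''k'' (Var ''M'') output_body) \<sigma>1 \<tau>"
        and inv: "\<forall>i<k. ratmem \<tau> ''edge_betweenness'' i = edge_betweenness G s (Earr ! i)"
      have "holds_edges \<tau> ''arr_tail'' ''arr_head'' ''arr_dep'' ''arr_trav'' Earr"
        using inp(2) unwritten_eqD(1)[OF u] by (simp add: body_defs holds_edges_def)
      then have "nval (NCode ''arr_tail'' ''arr_head'' ''arr_dep'' ''arr_trav'' (Var ''k'')) \<tau> = code (Earr ! k)"
        using nval_NCode[where a = "Var ''k''" and \<sigma> = \<tau> and es = Earr] k by simp
      moreover have e: "Earr ! k \<in> E"
        using k doubly_sorted nth_mem[of k Earr] by (auto simp: doubly_sorted_def)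
      moreover have "natmem \<tau> ''count'' = natmem \<sigma>1 ''count''" "ratmem \<tau> ''delta'' = ratmem \<sigma>1 ''delta''"
        using unwritten_eqD[OF u] by (simp_all add: body_defs)
      ultimately show "\<forall>i<Suc k. ratmem (nwrite ''k'' 0 (Suc k) (run output_body \<tau>)) ''edge_betweenness'' i
          = edge_betweenness G s (Earr ! i)"
        using inv k d1[OF e] by (simp add: output_body_def edge_betweenness_eq less_Suc_eq)
    qed (auto simp: body_defs)
    then show "runs (For ''k'' (Var ''M'') output_body) (loop_rate (Var ''M'') output_body * Suc M) \<sigma>1 ?Q"
    proof (rule runs_mono)
      fix \<tau> assume u: "unwritten_eq (For ''k'' (Var ''M'') output_body) \<sigma>1 \<tau>"
        and eb: "\<forall>i<M. ratmem \<tau> ''edge_betweenness'' i = edge_betweenness G s (Earr ! i)"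
      have "ratmem \<tau> ''node_betweenness'' = ratmem \<sigma>1 ''node_betweenness''"
        using unwritten_eqD[OF u] by (simp add: body_defs)
      then show "?Q \<tau>"
        using c1 eb by (simp add: backwarding_def after_0 in_edges_def)
    qed simp
  qed
  then show ?thesis by (rule runs_mono) (auto simp: algebra_simps)
qed


lemma runs_source:
  assumes "input \<sigma>"
  shows "runs source_prog (source_rate * Suc M) \<sigma>
    (\<lambda>\<tau>. (\<forall>i<M. ratmem \<tau> ''edge_betweenness'' i = edge_betweenness G s (Earr ! i)) \<and>
       (\<forall>u. ratmem \<tau> ''node_betweenness'' u = ratmem \<sigma> ''node_betweenness'' u +
          (\<Sum>e\<in>in_edges G u. of_nat (count e) * succ_delta e)))" (is "runs _ _ _ ?Q")
proof -
  have "runs source_prog ((6 + loop_rate MM merge_body) * Suc M +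
     ((loop_rate MM init_body + bound init_source + loop_rate MM forward_body) * Suc M +
     ((loop_rate MM clear_body + loop_rate MM key_body + loop_rate MM total_body) * Suc M +
     (loop_rate MM backward_body + loop_rate (Var ''M'') output_body) * Suc M))) \<sigma> ?Q"
    unfolding source_prog_def
  proof (rule runs_Seq[OF runs_merge[OF assms]], rule runs_Seq[OF runs_forward], assumption,
      rule runs_Seq[OF runs_weight], simp, simp)
    fix \<sigma>1 \<sigma>2 \<sigma>3
    assume u: "unwritten_eq merge_prog \<sigma> \<sigma>1" "unwritten_eq forward_prog \<sigma>1 \<sigma>2"
        "unwritten_eq weight_prog \<sigma>2 \<sigma>3"
      and Q: "loaded \<sigma>3 \<and> distances \<sigma>3 \<and> keys_minimal \<sigma>3 \<and> totals \<sigma>3 \<and> (\<forall>e\<in>E. zero_flow \<sigma>3 e)"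
    have "ratmem \<sigma>3 ''node_betweenness'' = ratmem \<sigma> ''node_betweenness''"
      using u[THEN unwritten_eqD(2), of "''node_betweenness''"]
      by (simp add: merge_prog_def forward_prog_def weight_prog_def body_defs)
    then show "runs finish_prog ((loop_rate MM backward_body + loop_rate (Var ''M'') output_body) * Suc M) \<sigma>3 ?Q"
      using runs_finish[of \<sigma>3] Q by simp
  qed
  then show ?thesis by (rule runs_mono) (auto simp: source_rate_def algebra_simps)
qed

end

section \<open>Iterating over all sources\<close>

lemma nwrites_source_prog:
  "nwrites source_prog \<subseteq> {''k'', ''i'', ''j'', ''q'', ''ev_kind'', ''ev_tail'', ''ev_head'', ''ev_arr'',
     ''ev_code'', ''D'', ''C'', ''dist'', ''count'', ''key'', ''total''}"
  by (simp add: source_prog_def merge_prog_def forward_prog_def weight_prog_def finish_prog_def body_defs)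

text \<open>In the bound, \<open>22\<close> is the loop slack 20 plus the cost 2 of reading
  \<open>n\<close>, and \<open>5\<close> is the cost of loading the source. The loop is sound
  because a pass changes neither the counter \<open>h\<close> nor the input.\<close>

lemma runs_node_prog:
  assumes graph: "temporal_graph G" "max_wait G = \<infinity>" and sorted: "doubly_sorted G Earr Edep"
    and inp: "holds_input \<sigma> G Earr Edep"
  shows "runs node_prog ((card (verts G) * (bound zero_body + 22) + 22) +
      (card (verts G) * (5 + source_rate * Suc (card (edges G)) + 22) + 22)) \<sigma>
    (\<lambda>\<tau>. \<forall>u\<in>verts G. ratmem \<tau> ''node_betweenness'' u = node_betweenness G u)"
proof -
  let ?n = "card (verts G)" and ?M = "card (edges G)"
  let ?node = "natmem \<sigma> ''node''"
  have node: "bij_betw ?node {..<?n} (verts G)" using inp by (simp add: holds_input_def)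
  have n: "natmem \<sigma> ''n'' 0 = ?n" using inp by (simp add: holds_input_def)
  have "runs (For ''h'' (Var ''n'') zero_body) (?n * (bound zero_body + ncost (Var ''n'') + 20) + ncost (Var ''n'') + 20) \<sigma>
      (\<lambda>\<tau>. \<forall>h<?n. ratmem \<tau> ''node_betweenness'' (?node h) = 0)"
  proof (rule runs_For[where I = "\<lambda>k \<tau>. \<forall>h<k. ratmem \<tau> ''node_betweenness'' (?node h) = 0"])
    fix \<tau> assume "unwritten_eq (For ''h'' (Var ''n'') zero_body) \<sigma> \<tau>"
    from unwritten_eqD(1)[OF this] n show "nval (Var ''n'') \<tau> = ?n" by (simp add: zero_body_def)
  next
    fix k \<tau>
    assume *: "natmem \<tau> ''h'' 0 = k" "unwritten_eq (For ''h'' (Var ''n'') zero_body) \<sigma> \<tau>"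
      "\<forall>h<k. ratmem \<tau> ''node_betweenness'' (?node h) = 0"
    have "natmem \<tau> ''node'' = ?node" using unwritten_eqD(1)[OF *(2)] by (simp add: zero_body_def)
    then show "runs zero_body (bound zero_body) \<tau>
        (\<lambda>\<tau>'. \<forall>h<Suc k. ratmem (nwrite ''h'' 0 (Suc k) \<tau>') ''node_betweenness'' (?node h) = 0)"
      using * by (intro runs_mono[OF runs_run]) (auto simp: zero_body_def less_Suc_eq)
  qed (simp_all add: zero_body_def)
  then have zero: "runs (For ''h'' (Var ''n'') zero_body) (?n * (bound zero_body + 22) + 22) \<sigma>
      (\<lambda>\<tau>. \<forall>u\<in>verts G. ratmem \<tau> ''node_betweenness'' u = 0)"
  proof (rule runs_mono)
    fix \<tau> assume z: "\<forall>h<?n. ratmem \<tau> ''node_betweenness'' (?node h) = 0"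
    have "ratmem \<tau> ''node_betweenness'' u = 0" if "u \<in> verts G" for u
    proof -
      have "u \<in> ?node ` {..<?n}" using that bij_betw_imp_surj_on[OF node] by blast
      then show ?thesis using z by blast
    qed
    then show "\<forall>u\<in>verts G. ratmem \<tau> ''node_betweenness'' u = 0" by blast
  qed simp
  show ?thesis
    unfolding node_prog_def
  proof (rule runs_Seq[OF zero])
    fix \<sigma>1 assume u1: "unwritten_eq (For ''h'' (Var ''n'') zero_body) \<sigma> \<sigma>1"
      and z1: "\<forall>u\<in>verts G. ratmem \<sigma>1 ''node_betweenness'' u = 0"
    let ?g = "\<lambda>s u. \<Sum>e\<in>in_edges G u. of_nat (sfo.count G s e) * sfo.succ_delta G s e :: rat"
    let ?I = "\<lambda>k \<tau>. \<forall>u\<in>verts G. ratmem \<tau> ''node_betweenness'' u = (\<Sum>h<k. ?g (?node h) u)"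
    have nw: "nwrites source_body = insert ''source'' (nwrites source_prog)"
      by (simp add: source_body_def)
    have keep: "natmem \<tau> x = natmem \<sigma> x"
      if u: "unwritten_eq (For ''h'' (Var ''n'') source_body) \<sigma>1 \<tau>"
        and "x \<in> {''n'', ''node'', ''M'', ''arr_tail'', ''arr_head'', ''arr_dep'', ''arr_trav'',
          ''dep_tail'', ''dep_head'', ''dep_dep'', ''dep_trav''}" for \<tau> x
    proof -
      have x: "x \<notin> insert ''h'' (insert ''source'' (nwrites source_prog))"
        using that(2) nwrites_source_prog by auto
      have "natmem \<tau> x = natmem \<sigma>1 x" using unwritten_eqD(1)[OF u] x nw by simp
      also have "\<dots> = natmem \<sigma> x" using unwritten_eqD(1)[OF u1] x by (simp add: zero_body_def)
      finally show ?thesis .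
    qed
    have "runs (For ''h'' (Var ''n'') source_body)
      (?n * (5 + source_rate * Suc ?M + ncost (Var ''n'') + 20) + ncost (Var ''n'') + 20) \<sigma>1 (?I ?n)"
    proof (rule runs_For[where I = ?I])
      show "''h'' \<notin> nwrites source_body" using nwrites_source_prog by (auto simp: nw)
    next
      fix \<tau> assume "unwritten_eq (For ''h'' (Var ''n'') source_body) \<sigma>1 \<tau>"
      from keep[OF this] n show "nval (Var ''n'') \<tau> = ?n" by simp
    next
      show "?I 0 (nwrite ''h'' 0 0 \<sigma>1)" using z1 by simp
    next
      fix k \<tau>
      assume k: "k < ?n" "natmem \<tau> ''h'' 0 = k" and u: "unwritten_eq (For ''h'' (Var ''n'') source_body) \<sigma>1 \<tau>"
        and inv: "?I k \<tau>"
      let ?s = "?node k"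
      interpret sfo_input G ?s Earr Edep
        using graph sorted by unfold_locales
      let ?c = "NWrite ''source'' (NConst 0) (NRead ''node'' (Var ''h''))"
      have nd: "natmem \<tau> ''node'' = ?node" using keep[OF u] by simp
      have "runs source_body (bound ?c + source_rate * Suc ?M) \<tau>
        (\<lambda>\<tau>'. ?I (Suc k) (nwrite ''h'' 0 (Suc k) \<tau>'))"
        unfolding source_body_def
      proof (rule runs_Seq[OF runs_run])
        fix \<tau>1 assume \<tau>1: "\<tau>1 = run ?c \<tau>"
        have "input \<tau>1"
          using inp keep[OF u] nd k unfolding input_def \<tau>1
          by (simp add: holds_input_def holds_edges_def)
        from runs_source[OF this] show "runs source_prog (source_rate * Suc ?M) \<tau>1
          (\<lambda>\<tau>'. ?I (Suc k) (nwrite ''h'' 0 (Suc k) \<tau>'))"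
        proof (rule runs_mono)
          fix \<tau>2 :: store
          assume "(\<forall>i<?M. ratmem \<tau>2 ''edge_betweenness'' i = edge_betweenness G ?s (Earr ! i)) \<and>
            (\<forall>u. ratmem \<tau>2 ''node_betweenness'' u = ratmem \<tau>1 ''node_betweenness'' u + ?g ?s u)"
          then have "ratmem \<tau>2 ''node_betweenness'' u = ratmem \<tau> ''node_betweenness'' u + ?g ?s u" for u
            by (simp add: \<tau>1)
          then show "?I (Suc k) (nwrite ''h'' 0 (Suc k) \<tau>2)"
            using inv by (simp only: ratmem_nwrite sum.lessThan_Suc cong: ball_cong) blast
        qed simp
      qed simp
      then show "runs source_body (5 + source_rate * Suc ?M) \<tau>
        (\<lambda>\<tau>'. ?I (Suc k) (nwrite ''h'' 0 (Suc k) \<tau>'))"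
        by (rule runs_mono) simp_all
    qed
    then show "runs (For ''h'' (Var ''n'') source_body) (?n * (5 + source_rate * Suc ?M + 22) + 22) \<sigma>1
      (\<lambda>\<tau>. \<forall>u\<in>verts G. ratmem \<tau> ''node_betweenness'' u = node_betweenness G u)"
    proof (rule runs_mono)
      fix \<tau> assume I: "?I ?n \<tau>"
      show "\<forall>u\<in>verts G. ratmem \<tau> ''node_betweenness'' u = node_betweenness G u"
      proof
        fix u assume u: "u \<in> verts G"
        have "ratmem \<tau> ''node_betweenness'' u = (\<Sum>h<?n. ?g (?node h) u)" using I u by blast
        \<comment> \<open>The array \<open>node\<close> lists every vertex once, so each source
          contributes exactly once.\<close>
        also have "\<dots> = (\<Sum>s\<in>verts G. ?g s u)" by (rule sum.reindex_bij_betw[OF node])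
        also have "\<dots> = node_betweenness G u" by (rule node_betweenness_eq[OF graph u, symmetric])
        finally show "ratmem \<tau> ''node_betweenness'' u = node_betweenness G u" .
      qed
    qed simp
  qed
qed

theorem theorem1:
  shows "(\<exists>P c. \<forall>G Earr Edep s \<sigma>.
      temporal_graph G \<and> max_wait G = \<infinity> \<and> doubly_sorted G Earr Edep \<and>
      holds_input \<sigma> G Earr Edep \<and> s \<in> verts G \<and> natmem \<sigma> ''source'' 0 = s \<longrightarrow>
      (\<exists>T \<sigma>'. exec P \<sigma> T \<sigma>' \<and>
         (\<forall>i < length Earr. ratmem \<sigma>' ''edge_betweenness'' i = edge_betweenness G s (Earr ! i)) \<and>
         (card (edges G) \<ge> 1 \<longrightarrow> T \<le> c * card (edges G))))
    \<and>
    (\<exists>P c. \<forall>G Earr Edep \<sigma>.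
      temporal_graph G \<and> max_wait G = \<infinity> \<and> doubly_sorted G Earr Edep \<and>
      holds_input \<sigma> G Earr Edep \<longrightarrow>
      (\<exists>T \<sigma>'. exec P \<sigma> T \<sigma>' \<and>
         (\<forall>u \<in> verts G. ratmem \<sigma>' ''node_betweenness'' u = node_betweenness G u) \<and>
         (card (edges G) \<ge> 1 \<longrightarrow> T \<le> c * (card (verts G) * card (edges G)))))"
proof (rule conjI; rule exI; rule exI; intro allI impI; elim conjE)
  fix G :: "nat tgraph" and Earr Edep s \<sigma>
  assume A: "temporal_graph G" "max_wait G = \<infinity>" "doubly_sorted G Earr Edep"
    "holds_input \<sigma> G Earr Edep" "natmem \<sigma> ''source'' 0 = s"
  interpret sfo_input G s Earr Edep
    using A by unfold_locales
  have "input \<sigma>" using A by (simp add: input_def holds_input_def)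
  from runs_source[OF this] obtain T \<tau> where T: "exec source_prog \<sigma> T \<tau>" "T \<le> source_rate * Suc M"
      "\<forall>i<M. ratmem \<tau> ''edge_betweenness'' i = edge_betweenness G s (Earr ! i)"
    unfolding runs_def by blast
  have "T \<le> (2 * source_rate) * M" if "1 \<le> M"
  proof -
    \<comment> \<open>Absorbing the additive constant needs at least one edge; it costs the factor
      2.\<close>
    have "source_rate * Suc M \<le> source_rate * (2 * M)" using that by (intro mult_le_mono2) simp
    then show ?thesis using T(2) by (simp only: mult.assoc mult.left_commute)
  qed
  then show "\<exists>T \<sigma>'. exec source_prog \<sigma> T \<sigma>' \<and>
      (\<forall>i<length Earr. ratmem \<sigma>' ''edge_betweenness'' i = edge_betweenness G s (Earr ! i)) \<and>
      (1 \<le> M \<longrightarrow> T \<le> (2 * source_rate) * M)"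
    using T by auto
next
  fix G :: "nat tgraph" and Earr Edep \<sigma>
  assume A: "temporal_graph G" "max_wait G = \<infinity>" "doubly_sorted G Earr Edep" "holds_input \<sigma> G Earr Edep"
  let ?n = "card (verts G)" and ?M = "card (edges G)"
  \<comment> \<open>Here 93 is 22 + 27 + 44: the overhead per node of the zeroing loop, that of the
    source loop (5 + 22), and the fixed costs of both loops.\<close>
  let ?c = "bound zero_body + 93 + 2 * source_rate"
  obtain T \<tau> where T: "exec node_prog \<sigma> T \<tau>"
      "T \<le> (?n * (bound zero_body + 22) + 22) + (?n * (5 + source_rate * Suc ?M + 22) + 22)"
      "\<forall>u\<in>verts G. ratmem \<tau> ''node_betweenness'' u = node_betweenness G u"
    using runs_node_prog[OF A] unfolding runs_def by blast
  have "T \<le> ?c * (?n * ?M)" if M: "1 \<le> ?M"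
  proof -
    \<comment> \<open>An edge forces a vertex, so \<open>?n * ?M\<close> is at least 1 and can
      absorb the fixed costs.\<close>
    have "edges G \<noteq> {}" using M by auto
    then have "verts G \<noteq> {}" "finite (verts G)" using A(1) by (auto simp: temporal_graph_def)
    then have n: "1 \<le> ?n" by (simp add: Suc_leI card_gt_0_iff)
    have nM: "?n \<le> ?n * ?M" using M by simp
    have 1: "1 \<le> ?n * ?M" using n nM by linarith
    have "T \<le> ?n * (bound zero_body + 22) + ?n * 27 + ?n * (source_rate * Suc ?M) + 44"
      using T(2) by (simp add: distrib_left)
    also have "\<dots> \<le> ?n * ?M * (bound zero_body + 22) + ?n * ?M * 27 + ?n * (source_rate * (2 * ?M)) + 44 * (?n * ?M)"
      using nM M 1 by (intro add_mono mult_le_mono1 mult_le_mono2) simp_all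
    also have "\<dots> = ?c * (?n * ?M)" by (simp add: algebra_simps)
    finally show ?thesis .
  qed
  then show "\<exists>T \<sigma>'. exec node_prog \<sigma> T \<sigma>' \<and>
      (\<forall>u\<in>verts G. ratmem \<sigma>' ''node_betweenness'' u = node_betweenness G u) \<and>
      (1 \<le> ?M \<longrightarrow> T \<le> ?c * (?n * ?M))"
    using T by auto
qed

end
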